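(* Let $n\ge1$ be an integer and $1\le p<\infty$. The spaces $\mathcal D_p(\mathbb R^{2n},\Delta_n)$, $\mathcal D_p(\mathbb R^{2n}_+,\Delta_n)$ and $\mathcal D_p(\mathbb R^{2n}_{\ge0},\Delta_n)$ have infinite Hausdorff, covering and asymptotic dimensions.
   Context: $\mathbb R^{2n}$ carries the Euclidean metric, and its subsets the restricted metric; $\Delta_n=\{(v,v)\in\mathbb R^{2n}:v\in\mathbb R^n\}$; $\mathbb R^{2n}_+=\{(x_1,\dots,x_n,y_1,\dots,y_n)\in\mathbb R^{2n}:x_i\le y_i,\ i=1,\dots,n\}$; $\mathbb R^{2n}_{\ge0}=\{(x_1,\dots,x_n,y_1,\dots,y_n)\in\mathbb R^{2n}:0\le x_i\le y_i,\ i=1,\dots,n\}$. In the pair $(\mathbb R^{2n}_{\ge0},\Delta_n)$, $\Delta_n$ stands for $\Delta_n\cap\mathbb R^{2n}_{\ge0}$. Persistence diagrams on a metric space $(X,d)$ relative to a non-empty closed subset $A$ ($1\le p<\infty$): for a set $Y$, let $\widetilde{\mathcal D}(Y)$ be the set of countable (finite or countably infinite) multisets of elements of $Y$; the sum of two multisets is their disjoint union. For $\widetilde\sigma,\widetilde\tau\in\widetilde{\mathcal D}(X)$ put $\widetilde d_p(\widetilde\sigma,\widetilde\tau)=\inf_\phi\big(\sum_{x\in\widetilde\sigma}d(x,\phi(x))^p\big)^{1/p}$ over all bijections $\phi\colon\widetilde\sigma\to\widetilde\tau$ of multisets ($\inf\varnothing=\infty$). Write $\widetilde\sigma\sim_A\widetilde\tau$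 if $\widetilde\sigma+\widetilde\alpha=\widetilde\tau+\widetilde\beta$ for some $\widetilde\alpha,\widetilde\beta\in\widetilde{\mathcal D}(A)$; let $\mathcal D(X,A)=\widetilde{\mathcal D}(X)/\!\sim_A$, with $\sigma$ the class of $\widetilde\sigma$ and $\sigma_\varnothing$ the class of the empty multiset. Put $d_p(\sigma,\tau)=\inf_{\widetilde\alpha,\widetilde\beta\in\widetilde{\mathcal D}(A)}\widetilde d_p(\widetilde\sigma+\widetilde\alpha,\widetilde\tau+\widetilde\beta)$ and $\mathcal D_p(X,A)=\{\sigma: d_p(\sigma,\sigma_\varnothing)<\infty\}$ with the metric $d_p$. Dimensions of a metric space $M$. Covering dimension: the least $m$ such that every finite open cover of $M$ has an open refinement in which each point belongs to at most $m+1$ members ($\infty$ if none). Hausdorff dimension: the usual one. Asymptotic dimension: the least $m$ such that for every $R>0$ there is a cover of $M$ by sets of uniformly bounded diameter such that every ball of radius $R$ meets at most $m+1$ members ($\infty$ if none). *)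

theory Defs
  imports "HOL-Analysis.Analysis" "HOL-Library.Extended_Nat" "HOL-Library.Function_Algebras"
begin

section \<open>Countable multisets\<close>

text \<open>A countable multiset is given by its multiplicity function. Multiplicities may be infinite,
  so \<^typ>\<open>'a multiset\<close> does not apply. The sum of multisets and the empty multiset are the
  pointwise \<open>+\<close> and \<open>0\<close> on functions.\<close>

type_synonym 'a cmset = "'a \<Rightarrow> enat"

definition cmsets :: "'a set \<Rightarrow> 'a cmset set" where
  "cmsets Y = {s. countable {x. s x \<noteq> 0} \<and> {x. s x \<noteq> 0} \<subseteq> Y}"

text \<open>The elements of a multiset counted with multiplicity: \<open>(x, i)\<close> is the \<open>i\<close>-th copy of \<open>x\<close>.
  A bijection of multisets is a bijection between these sets.\<close>

definition copies :: "'a cmset \<Rightarrow> ('a \<times> nat) set" where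
  "copies s = {(x, i). enat i < s x}"


section \<open>Spaces of persistence diagrams\<close>

text \<open>Real powers of extended nonnegative reals, only meant for exponents \<open>r > 0\<close>.\<close>

definition ennreal_rpow :: "ennreal \<Rightarrow> real \<Rightarrow> ennreal" where
  "ennreal_rpow a r = (if a = \<infinity> then \<infinity> else ennreal (enn2real a powr r))"

text \<open>\<^const>\<open>Inf\<close> of the empty set is \<open>\<infinity>\<close> in \<^typ>\<open>ennreal\<close>.\<close>

definition matching_dist :: "real \<Rightarrow> 'a::metric_space cmset \<Rightarrow> 'a cmset \<Rightarrow> ennreal" where
  "matching_dist p s t =
     (INF \<phi>\<in>{\<phi>. bij_betw \<phi> (copies s) (copies t)}.
        ennreal_rpow (\<Sum>\<^sub>\<infinity>c\<in>copies s. ennreal (dist (fst c) (fst (\<phi> c)) powr p)) (1 / p))"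

definition dgm_rel :: "'a set \<Rightarrow> 'a set \<Rightarrow> ('a cmset \<times> 'a cmset) set" where
  "dgm_rel X A = {(s, t). s \<in> cmsets X \<and> t \<in> cmsets X \<and>
                          (\<exists>\<alpha>\<in>cmsets A. \<exists>\<beta>\<in>cmsets A. s + \<alpha> = t + \<beta>)}"

definition dgms :: "'a set \<Rightarrow> 'a set \<Rightarrow> 'a cmset set set" where
  "dgms X A = cmsets X // dgm_rel X A"

definition empty_dgm :: "'a set \<Rightarrow> 'a set \<Rightarrow> 'a cmset set" where
  "empty_dgm X A = dgm_rel X A `` {0}"

definition rep_dist :: "real \<Rightarrow> 'a::metric_space set \<Rightarrow> 'a cmset \<Rightarrow> 'a cmset \<Rightarrow> ennreal" where
  "rep_dist p A s t = (INF \<alpha>\<in>cmsets A. INF \<beta>\<in>cmsets A. matching_dist p (s + \<alpha>) (t + \<beta>))"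

text \<open>The choice of representatives is immaterial, see \<open>dgm_dist_class\<close> below.\<close>

definition dgm_dist ::
  "real \<Rightarrow> 'a::metric_space set \<Rightarrow> 'a cmset set \<Rightarrow> 'a cmset set \<Rightarrow> ennreal" where
  "dgm_dist p A \<sigma> \<tau> = rep_dist p A (SOME s. s \<in> \<sigma>) (SOME t. t \<in> \<tau>)"

definition dgm_space :: "real \<Rightarrow> 'a::metric_space set \<Rightarrow> 'a set \<Rightarrow> 'a cmset set set" where
  "dgm_space p X A = {\<sigma> \<in> dgms X A. dgm_dist p A \<sigma> (empty_dgm X A) < \<infinity>}"

text \<open>The real-valued metric on \<^const>\<open>dgm_space\<close>; on that set \<^const>\<open>dgm_dist\<close> is finite.\<close>

definition dgm_mdist ::
  "real \<Rightarrow> 'a::metric_space set \<Rightarrow> 'a cmset set \<Rightarrow> 'a cmset set \<Rightarrow> real" where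
  "dgm_mdist p A \<sigma> \<tau> = enn2real (dgm_dist p A \<sigma> \<tau>)"


subsection \<open>Independence of representatives\<close>

lemma cmsets_add: "s \<in> cmsets Y \<Longrightarrow> t \<in> cmsets Y \<Longrightarrow> s + t \<in> cmsets Y"
proof -
  assume "s \<in> cmsets Y" "t \<in> cmsets Y"
  moreover have "{x. (s + t) x \<noteq> 0} = {x. s x \<noteq> 0} \<union> {x. t x \<noteq> 0}"
    by auto
  ultimately show ?thesis
    unfolding cmsets_def mem_Collect_eq by simp
qed

lemma cmsets_0: "0 \<in> cmsets Y"
  by (simp add: cmsets_def)

lemma equiv_dgm_rel: "equiv (cmsets X) (dgm_rel X A)"
proof (rule equivI)
  show "dgm_rel X A \<subseteq> cmsets X \<times> cmsets X"
    by (auto simp: dgm_rel_def)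
  show "refl_on (cmsets X) (dgm_rel X A)"
    unfolding refl_on_def dgm_rel_def using cmsets_0 by fastforce
  show "sym (dgm_rel X A)"
    unfolding sym_def dgm_rel_def by (auto; metis)
  show "trans (dgm_rel X A)"
  proof (rule transI)
    fix s t u assume "(s, t) \<in> dgm_rel X A" "(t, u) \<in> dgm_rel X A"
    then obtain a b a' b' where *: "s \<in> cmsets X" "u \<in> cmsets X"
      "a \<in> cmsets A" "b \<in> cmsets A" "a' \<in> cmsets A" "b' \<in> cmsets A"
      "s + a = t + b" "t + a' = u + b'"
      by (auto simp: dgm_rel_def)
    have "s + (a + a') = t + b + a'" using * by (metis add.assoc)
    also have "\<dots> = u + (b' + b)" using * by (metis add.assoc add.commute)
    finally show "(s, u) \<in> dgm_rel X A"
      unfolding dgm_rel_def using * cmsets_add by blast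
  qed
qed

lemma copies_add_bij:
  obtains h where "bij_betw h (copies (s + t)) (copies s <+> copies t)"
    "\<And>c. c \<in> copies (s + t) \<Longrightarrow> fst c = (case h c of Inl a \<Rightarrow> fst a | Inr b \<Rightarrow> fst b)"
proof -
  let ?I = "\<lambda>n::enat. {i. enat i < n}"
  have fin: "?I (enat n) = {..<n}" and inf: "?I \<infinity> = UNIV" for n
    by auto
  have "\<exists>g. bij_betw g (?I (m + n)) (?I m <+> ?I n)" for m n
  proof (cases "m = \<infinity> \<or> n = \<infinity>")
    case True
    then have "infinite (?I m <+> ?I n)" "?I (m + n) = UNIV"
      by (auto simp: finite_Plus_iff)
    moreover have "countable (?I m <+> ?I n)"
      by simp
    ultimately show ?thesis
      by (metis bij_betw_from_nat_into)
  next
    case False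
    then obtain k l where "m = enat k" "n = enat l" by auto
    then show ?thesis
      by (intro finite_same_card_bij) (simp_all add: fin card_Plus)
  qed
  then have "\<forall>x. \<exists>g. bij_betw g (?I (s x + t x)) (?I (s x) <+> ?I (t x))"
    by blast
  then obtain g where g: "\<And>x. bij_betw (g x) (?I (s x + t x)) (?I (s x) <+> ?I (t x))"
    by metis
  define h where "h = (\<lambda>(x, i). case g x i of Inl j \<Rightarrow> Inl (x, j) | Inr j \<Rightarrow> Inr (x, j))"
  define k where "k = (\<lambda>c. case c of Inl (x, j) \<Rightarrow> (x, inv_into (?I (s x + t x)) (g x) (Inl j))
                                 | Inr (x, j) \<Rightarrow> (x, inv_into (?I (s x + t x)) (g x) (Inr j)))"
  have mem: "g x i \<in> ?I (s x) <+> ?I (t x)" if "enat i < s x + t x" for x i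
    using bij_betwE[OF g[of x]] that by blast
  have 1: "h c \<in> copies s <+> copies t \<and> k (h c) = c" if c0: "c \<in> copies (s + t)" for c
  proof -
    obtain x i where c: "c = (x, i)" "enat i < s x + t x"
      using c0 by (cases c) (auto simp: copies_def)
    have "inv_into (?I (s x + t x)) (g x) (g x i) = i"
      using bij_betw_inv_into_left[OF g[of x]] c by simp
    then show ?thesis
      using mem[OF c(2)] c by (auto simp: h_def k_def copies_def)
  qed
  have 2: "k c \<in> copies (s + t) \<and> h (k c) = c" if "c \<in> copies s <+> copies t" for c
  proof -
    have *: "enat (inv_into (?I (s x + t x)) (g x) y) < s x + t x \<and>
             g x (inv_into (?I (s x + t x)) (g x) y) = y"
      if "y \<in> ?I (s x) <+> ?I (t x)" for x y
      using bij_betw_inv_into_right[OF g[of x] that]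
            bij_betwE[OF bij_betw_inv_into[OF g[of x]]] that by blast
    from that show ?thesis
    proof
      fix a assume "c = Inl a" "a \<in> copies s"
      then show ?thesis
        using *[of "Inl (snd a)" "fst a"] by (auto simp: h_def k_def copies_def Plus_def)
    next
      fix a assume "c = Inr a" "a \<in> copies t"
      then show ?thesis
        using *[of "Inr (snd a)" "fst a"] by (auto simp: h_def k_def copies_def Plus_def)
    qed
  qed
  have "bij_betw h (copies (s + t)) (copies s <+> copies t)"
    by (rule bij_betw_byWitness[where f' = k]) (use 1 2 in blast)+
  moreover have "fst c = (case h c of Inl a \<Rightarrow> fst a | Inr b \<Rightarrow> fst b)" for c
    by (auto simp: h_def split: sum.splits prod.splits)
  ultimately show ?thesis
    using that by blast
qed

lemma matching_dist_add_le: "matching_dist p (s + u) (t + u) \<le> matching_dist p s t"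
  unfolding matching_dist_def
proof (rule INF_mono)
  fix \<phi> assume "\<phi> \<in> {\<phi>. bij_betw \<phi> (copies s) (copies t)}"
  then have \<phi>: "bij_betw \<phi> (copies s) (copies t)" by simp
  obtain h where h: "bij_betw h (copies (s + u)) (copies s <+> copies u)"
    "\<And>c. c \<in> copies (s + u) \<Longrightarrow> fst c = (case h c of Inl a \<Rightarrow> fst a | Inr b \<Rightarrow> fst b)"
    using copies_add_bij by blast
  obtain k where k: "bij_betw k (copies (t + u)) (copies t <+> copies u)"
    "\<And>c. c \<in> copies (t + u) \<Longrightarrow> fst c = (case k c of Inl a \<Rightarrow> fst a | Inr b \<Rightarrow> fst b)"
    using copies_add_bij by blast
  define k' where "k' = inv_into (copies (t + u)) k"
  define m where "m = map_sum \<phi> (id :: 'a \<times> nat \<Rightarrow> _)"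
  have m: "bij_betw m (copies s <+> copies u) (copies t <+> copies u)"
    unfolding m_def
    by (rule bij_betw_byWitness[where f' = "map_sum (inv_into (copies s) \<phi>) id"])
       (use bij_betwE[OF \<phi>] bij_betwE[OF bij_betw_inv_into[OF \<phi>]]
         bij_betw_inv_into_left[OF \<phi>] bij_betw_inv_into_right[OF \<phi>] in auto)
  have k': "bij_betw k' (copies t <+> copies u) (copies (t + u))"
    unfolding k'_def by (rule bij_betw_inv_into[OF k(1)])
  have fk': "fst (k' c) = (case c of Inl a \<Rightarrow> fst a | Inr b \<Rightarrow> fst b)"
    if "c \<in> copies t <+> copies u" for c
    using k(2)[of "k' c"] bij_betwE[OF k'] bij_betw_inv_into_right[OF k(1) that] that
    by (simp add: k'_def)
  let ?\<psi> = "k' \<circ> (m \<circ> h)"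
  have \<psi>: "bij_betw ?\<psi> (copies (s + u)) (copies (t + u))"
    by (intro bij_betw_trans[OF _ k'] bij_betw_trans[OF h(1)] m)
  define F where "F = (\<lambda>c. case c of
      Inl a \<Rightarrow> ennreal (dist (fst a) (fst (\<phi> a)) powr p) | Inr (b :: 'a \<times> nat) \<Rightarrow> 0)"
  have "(\<Sum>\<^sub>\<infinity>c\<in>copies (s + u). ennreal (dist (fst c) (fst (?\<psi> c)) powr p))
        = (\<Sum>\<^sub>\<infinity>c\<in>copies (s + u). F (h c))"
  proof (rule infsum_cong)
    fix c assume c: "c \<in> copies (s + u)"
    have hc: "h c \<in> copies s <+> copies u" using c by (rule bspec[OF bij_betwE[OF h(1)]])
    then have "m (h c) \<in> copies t <+> copies u" by (rule bspec[OF bij_betwE[OF m]])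
    then have *: "fst (?\<psi> c) = (case m (h c) of Inl a \<Rightarrow> fst a | Inr b \<Rightarrow> fst b)"
      using fk' by simp
    show "ennreal (dist (fst c) (fst (?\<psi> c)) powr p) = F (h c)"
      unfolding * h(2)[OF c] by (cases "h c") (simp_all add: F_def m_def)
  qed
  also have "\<dots> = infsum F (copies s <+> copies u)"
    by (rule infsum_reindex_bij_betw[OF h(1)])
  also have "\<dots> = infsum F (Inl ` copies s)"
    by (rule infsum_cong_neutral) (auto simp: F_def)
  also have "\<dots> = (\<Sum>\<^sub>\<infinity>c\<in>copies s. ennreal (dist (fst c) (fst (\<phi> c)) powr p))"
    by (subst infsum_reindex) (auto simp: F_def o_def)
  finally show "\<exists>\<psi>\<in>{\<psi>. bij_betw \<psi> (copies (s + u)) (copies (t + u))}.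
      ennreal_rpow (\<Sum>\<^sub>\<infinity>c\<in>copies (s + u). ennreal (dist (fst c) (fst (\<psi> c)) powr p)) (1 / p)
      \<le> ennreal_rpow (\<Sum>\<^sub>\<infinity>c\<in>copies s. ennreal (dist (fst c) (fst (\<phi> c)) powr p)) (1 / p)"
    using \<psi> by (intro bexI[of _ ?\<psi>]) simp_all
qed

lemma rep_dist_le:
  assumes "(s, s') \<in> dgm_rel X A" "(t, t') \<in> dgm_rel X A"
  shows "rep_dist p A s' t' \<le> rep_dist p A s t"
proof -
  obtain a b where ab: "a \<in> cmsets A" "b \<in> cmsets A" "s + a = s' + b"
    using assms(1) by (auto simp: dgm_rel_def)
  obtain a' b' where ab': "a' \<in> cmsets A" "b' \<in> cmsets A" "t + a' = t' + b'"
    using assms(2) by (auto simp: dgm_rel_def)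
  have "rep_dist p A s' t' \<le> matching_dist p (s + \<alpha>) (t + \<beta>)"
    if "\<alpha> \<in> cmsets A" "\<beta> \<in> cmsets A" for \<alpha> \<beta>
  proof -
    have "rep_dist p A s' t' \<le> matching_dist p (s' + (b + (\<alpha> + a'))) (t' + (b' + (\<beta> + a)))"
      unfolding rep_dist_def
      by (rule INF_lower2[of "b + (\<alpha> + a')"], use that ab ab' in \<open>simp add: cmsets_add\<close>,
          rule INF_lower, use that ab ab' in \<open>simp add: cmsets_add\<close>)
    also have "s' + (b + (\<alpha> + a')) = s + \<alpha> + (a + a')"
      using arg_cong[OF ab(3), of "\<lambda>v. v + (\<alpha> + a')"] by (simp add: ac_simps)
    also have "t' + (b' + (\<beta> + a)) = t + \<beta> + (a + a')"
      using arg_cong[OF ab'(3), of "\<lambda>v. v + (\<beta> + a)"] by (simp add: ac_simps)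
    also have "matching_dist p (s + \<alpha> + (a + a')) (t + \<beta> + (a + a')) \<le> matching_dist p (s + \<alpha>) (t + \<beta>)"
      by (rule matching_dist_add_le)
    finally show ?thesis .
  qed
  then show ?thesis
    unfolding rep_dist_def[of p A s t] by (intro INF_greatest)
qed

lemma dgm_dist_class:
  assumes "s \<in> cmsets X" "t \<in> cmsets X"
  shows "dgm_dist p A (dgm_rel X A `` {s}) (dgm_rel X A `` {t}) = rep_dist p A s t"
proof -
  have *: "(r, SOME r'. r' \<in> dgm_rel X A `` {r}) \<in> dgm_rel X A" if "r \<in> cmsets X" for r
    using someI[of "\<lambda>r'. r' \<in> dgm_rel X A `` {r}", OF equiv_class_self[OF equiv_dgm_rel that]]
    by simp
  have sym: "(t, s) \<in> dgm_rel X A" if "(s, t) \<in> dgm_rel X A" for s t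
    using that by (auto simp: dgm_rel_def) metis
  show ?thesis
    unfolding dgm_dist_def
    using rep_dist_le[OF *[OF assms(1)] *[OF assms(2)]]
      rep_dist_le[OF sym[OF *[OF assms(1)]] sym[OF *[OF assms(2)]]]
    by (rule antisym)
qed


section \<open>Dimensions of a metric space\<close>

definition covering_dim_le :: "'a topology \<Rightarrow> nat \<Rightarrow> bool" where
  "covering_dim_le T m \<longleftrightarrow>
     (\<forall>\<U>. finite \<U> \<and> (\<forall>U\<in>\<U>. openin T U) \<and> \<Union>\<U> = topspace T \<longrightarrow>
        (\<exists>\<V>. (\<forall>V\<in>\<V>. openin T V) \<and> \<Union>\<V> = topspace T \<and> (\<forall>V\<in>\<V>. \<exists>U\<in>\<U>. V \<subseteq> U) \<and>
             (\<forall>x\<in>topspace T. finite {V\<in>\<V>. x \<in> V} \<and> card {V\<in>\<V>. x \<in> V} \<le> m + 1)))"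

context Metric_space
begin

definition covering_dim :: enat where
  "covering_dim = Inf {enat m | m. covering_dim_le mtopology m}"

definition asymptotic_dim_le :: "nat \<Rightarrow> bool" where
  "asymptotic_dim_le m \<longleftrightarrow>
     (\<forall>R>0. \<exists>\<U>. \<Union>\<U> = M \<and> (\<exists>D. \<forall>U\<in>\<U>. \<forall>x\<in>U. \<forall>y\<in>U. d x y \<le> D) \<and>
        (\<forall>x\<in>M. finite {U\<in>\<U>. U \<inter> mball x R \<noteq> {}} \<and> card {U\<in>\<U>. U \<inter> mball x R \<noteq> {}} \<le> m + 1))"

definition asymptotic_dim :: enat where
  "asymptotic_dim = Inf {enat m | m. asymptotic_dim_le m}"

definition mdiam :: "'a set \<Rightarrow> ennreal" where
  "mdiam U = (SUP x\<in>U. SUP y\<in>U. ennreal (d x y))"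

definition hausdorff_premeasure :: "real \<Rightarrow> real \<Rightarrow> 'a set \<Rightarrow> ennreal" where
  "hausdorff_premeasure s \<delta> E =
     (INF U\<in>{U :: nat \<Rightarrow> 'a set. (\<forall>i. U i \<subseteq> M \<and> mdiam (U i) \<le> ennreal \<delta>) \<and> E \<subseteq> (\<Union>i. U i)}.
        \<Sum>i. ennreal_rpow (mdiam (U i)) s)"

definition hausdorff_measure :: "real \<Rightarrow> 'a set \<Rightarrow> ennreal" where
  "hausdorff_measure s E = (SUP \<delta>\<in>{0<..}. hausdorff_premeasure s \<delta> E)"

text \<open>Only exponents \<open>s > 0\<close> are used, so no convention for \<open>0\<^sup>0\<close> is needed;
  leaving out \<open>s = 0\<close> does not change the infimum.\<close>

definition hausdorff_dim :: ennreal where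
  "hausdorff_dim = Inf {ennreal s | s. 0 < s \<and> hausdorff_measure s M = 0}"

end


section \<open>The Euclidean pairs\<close>

text \<open>The Euclidean space of dimension \<open>2n\<close> with \<open>n = CARD('n)\<close> is rendered as
  \<^typ>\<open>(real ^ 'n) \<times> (real ^ 'n)\<close>, with \<open>(x, y)\<close> for \<open>(x\<^sub>1, \<dots>, x\<^sub>n, y\<^sub>1, \<dots>, y\<^sub>n)\<close>;
  its product metric is the Euclidean one.\<close>

definition diag :: "((real ^ 'n) \<times> (real ^ 'n)) set" where
  "diag = {(v, v) | v. True}"

definition euclid_plus :: "((real ^ 'n) \<times> (real ^ 'n)) set" where
  "euclid_plus = {(x, y). \<forall>i. x $ i \<le> y $ i}"

definition euclid_nonneg :: "((real ^ 'n) \<times> (real ^ 'n)) set" where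
  "euclid_nonneg = {(x, y). \<forall>i. 0 \<le> x $ i \<and> x $ i \<le> y $ i}"

end

theory Submission
  imports Defs
begin

text \<open>All three dimensions are forced up by cubes. If \<open>g\<close> is an isometric ray in \<open>X\<close> that moves away from \<open>A\<close>
  at a linear rate, then \<open>k\<close> points can be spread along it so far apart and so far out that all
  gaps and all distances to \<open>A\<close> stay at least \<open>L\<close> while each point is moved by a parameter in
  \<open>[0, L]\<close>. The diagram formed by the \<open>k\<close> points depends on the \<open>k\<close> parameters in a
  bi-Lipschitz way: moving each point along the ray is one possible matching, and a
  matching that treats one of these points differently costs at least \<open>L\<close>, because it sends the
  point to \<open>A\<close> or across a gap. The space
  of diagrams thus contains bi-Lipschitz copies of the cubes \<open>[0, L]\<^sup>k\<close> for all \<open>k\<close> and \<open>L\<close>, with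
  constants that do not depend on \<open>L\<close> (\<open>infinite_dimensions_dgm_space\<close>).

  For the covering and the asymptotic dimension, the obstruction is the combinatorial content of
  Lebesgue's covering theorem: if the points of the grid \<open>{0..N}\<^sup>k\<close> are coloured so that no colour
  occurs on two opposite faces, some unit cell carries \<open>k + 1\<close> colours. Colour a grid point by a
  member of a cover of the cube. A fine grid and the Lebesgue number of an open cover give the
  bound on the covering dimension; a grid of step one in a cube that is larger than all members
  of the cover gives the bound on the asymptotic dimension. The Hausdorff measure of exponent
  \<open>s \<le> k\<close> of a metric space with a \<open>k\<close>-dimensional cube is positive by comparison with volume.

  The dimensions are taken in a metric space, so the metric axioms of the space of diagrams are
  needed as well. The triangle inequality is Minkowski's inequality along a composition of
  matchings. Two diagrams at distance zero have equal multiplicities off \<open>A\<close>, because a diagram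
  of finite \<open>p\<close>-norm has only finitely many points near any point off \<open>A\<close>.\<close>

section \<open>Colourings of grids and dimensions of metric spaces with large cubes\<close>

text \<open>The colour of a grid point determines its Kuhn label: coordinate \<open>j\<close> gets the label \<open>0\<close> exactly
  when the colour occurs somewhere on the face \<open>x j = 0\<close>. As no colour occurs on opposite faces,
  the boundary conditions of Kuhn's combinatorial lemma hold, and the lemma yields a simplex on
  which the reduced label takes \<open>k + 1\<close> values. The reduced label is a function of the colour, so
  at least as many colours occur.\<close>

lemma grid_colouring:
  fixes c :: "(nat \<Rightarrow> nat) \<Rightarrow> 'b"
  assumes "0 < N"
    and opp: "\<And>x y i. \<lbrakk>\<And>j. x j \<le> N; \<And>j. y j \<le> N; i < k; x i = 0; y i = N\<rbrakk> \<Longrightarrow> c x \<noteq> c y"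
  obtains s where "finite s" "\<And>x j. x \<in> s \<Longrightarrow> x j \<le> N"
    "\<And>x y j. x \<in> s \<Longrightarrow> y \<in> s \<Longrightarrow> \<bar>real (x j) - real (y j)\<bar> \<le> 1" "k < card (c ` s)"
proof -
  define L where
    "L = (\<lambda>v j. if \<exists>x. (\<forall>j. x j \<le> N) \<and> x j = 0 \<and> c x = v then 0 else 1 :: nat)"
  have "odd (card {s. ksimplex N k s \<and> (reduced k \<circ> (\<lambda>x. L (c x))) ` s = {..k}})"
  proof (rule kuhn_combinatorial[OF \<open>0 < N\<close>]; intro allI impI)
    fix x j assume "(\<forall>j. x j \<le> N) \<and> j < k \<and> x j = 0"
    then show "L (c x) j = 0"
      unfolding L_def by (auto intro!: exI[of _ x])
  next
    fix x j assume "(\<forall>j. x j \<le> N) \<and> j < k \<and> x j = N"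
    then show "L (c x) j = 1"
      unfolding L_def using opp by (metis (full_types))
  qed
  then have "{s. ksimplex N k s \<and> (reduced k \<circ> (\<lambda>x. L (c x))) ` s = {..k}} \<noteq> {}"
    by (rule odd_card_imp_not_empty)
  then obtain s b u where "kuhn_simplex N k b u s"
    and rl: "(reduced k \<circ> (\<lambda>x. L (c x))) ` s = {..k}"
    by (auto elim: ksimplex.cases)
  interpret kuhn_simplex N k b u s by fact
  have finite_s: "finite s"
    by (simp add: s_eq)
  have "(reduced k \<circ> L) ` c ` s = {..k}"
    using rl by (simp add: image_image o_def)
  then have "card {..k} \<le> card (c ` s)"
    by (metis card_image_le finite_imageI finite_s)
  moreover have "\<bar>real (x j) - real (y j)\<bar> \<le> 1" if "x \<in> s" "y \<in> s" for x y j
    using base_le[OF that(1), of j] base_le[OF that(2), of j]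
      le_Suc_base[OF that(1), of j] le_Suc_base[OF that(2), of j] by linarith
  ultimately show ?thesis
    using finite_s s_le_p by (intro that) auto
qed

context Metric_space
begin

text \<open>A bi-Lipschitz parametrisation of a subset of the space by the cube \<open>[0, L]\<^sup>k\<close> with the maximum
  norm. Points of the cube are functions of which only the first \<open>k\<close> values matter.\<close>

definition cube_embedding :: "nat \<Rightarrow> real \<Rightarrow> ((nat \<Rightarrow> real) \<Rightarrow> 'a) \<Rightarrow> bool" where
  "cube_embedding k L e \<longleftrightarrow>
     (\<forall>x\<in>{..<k} \<rightarrow> {0..L}. e x \<in> M \<and>
        (\<forall>y\<in>{..<k} \<rightarrow> {0..L}.
           (\<forall>i<k. \<bar>x i - y i\<bar> \<le> d (e x) (e y)) \<and>
           (\<forall>\<delta>. (\<forall>i<k. \<bar>x i - y i\<bar> \<le> \<delta>) \<longrightarrow> d (e x) (e y) \<le> real k * \<delta>)))"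

lemma cube_embeddingD:
  assumes "cube_embedding k L e" "x \<in> {..<k} \<rightarrow> {0..L}"
  shows "e x \<in> M"
    and "y \<in> {..<k} \<rightarrow> {0..L} \<Longrightarrow> i < k \<Longrightarrow> \<bar>x i - y i\<bar> \<le> d (e x) (e y)"
    and "y \<in> {..<k} \<rightarrow> {0..L} \<Longrightarrow> (\<And>i. i < k \<Longrightarrow> \<bar>x i - y i\<bar> \<le> \<delta>) \<Longrightarrow> d (e x) (e y) \<le> real k * \<delta>"
  using assms unfolding cube_embedding_def by blast+

text \<open>Two parameters that agree on the first \<open>k\<close> coordinates have distance at most \<open>k * 0\<close>, hence the
  same image. It is therefore enough to look at extensional parameters, which form a compact
  subset of a finite product of lines.\<close>

lemma compactin_cube_embedding:
  assumes e: "cube_embedding k L e"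
  shows "compactin mtopology (e ` ({..<k} \<rightarrow> {0..L}))"
proof -
  let ?P = "product_topology (\<lambda>_. euclideanreal) {..<k}"
  let ?Q = "{..<k} \<rightarrow>\<^sub>E {0..L}"
  have cont: "continuous_map (subtopology ?P ?Q) mtopology e"
    unfolding continuous_map_to_metric
  proof (intro ballI allI impI)
    fix x and r :: real assume x: "x \<in> topspace (subtopology ?P ?Q)" and r: "0 < r"
    then have xQ: "x \<in> ?Q" by auto
    define \<delta> where "\<delta> = r / (real k + 1)"
    have \<delta>: "0 < \<delta>" "real k * \<delta> < r"
      using r by (auto simp: \<delta>_def field_simps)
    let ?U = "?Q \<inter> PiE {..<k} (\<lambda>i. ball (x i) \<delta>)"
    have "openin (subtopology ?P ?Q) ?U"
      by (intro openin_subtopology_Int2) (simp add: openin_PiE_gen)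
    moreover have "x \<in> ?U"
      using xQ \<delta> by (auto simp: PiE_iff)
    moreover have "e y \<in> mball (e x) r" if "y \<in> ?U" for y
    proof -
      have Q: "x \<in> {..<k} \<rightarrow> {0..L}" "y \<in> {..<k} \<rightarrow> {0..L}"
        using xQ that by auto
      have "\<bar>x i - y i\<bar> \<le> \<delta>" if "i < k" for i
        using \<open>y \<in> ?U\<close> that by (force simp: PiE_iff dist_real_def)
      then have "d (e x) (e y) < r"
        using cube_embeddingD(3)[OF e Q] \<delta>(2) by (meson order_le_less_trans)
      then show ?thesis
        using cube_embeddingD(1)[OF e] Q by simp
    qed
    ultimately show "\<exists>U. openin (subtopology ?P ?Q) U \<and> x \<in> U \<and> (\<forall>y\<in>U. e y \<in> mball (e x) r)"
      by (intro exI[of _ ?U]) simp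
  qed
  have "compactin ?P ?Q"
    by (simp add: compactin_PiE)
  then have "compactin (subtopology ?P ?Q) ?Q"
    by (simp add: compactin_subtopology)
  then have "compactin mtopology (e ` ?Q)"
    using cont by (rule image_compactin)
  moreover have "e x \<in> e ` ?Q" if x: "x \<in> {..<k} \<rightarrow> {0..L}" for x
  proof -
    let ?y = "restrict x {..<k}"
    have y: "?y \<in> {..<k} \<rightarrow> {0..L}" "?y \<in> ?Q"
      using x by auto
    have "d (e x) (e ?y) \<le> real k * 0"
      by (rule cube_embeddingD(3)[OF e x y(1)]) simp
    then have "e x = e ?y"
      using cube_embeddingD(1)[OF e x] cube_embeddingD(1)[OF e y(1)] nonneg[of "e x" "e ?y"]
      by (metis mult_zero_right order_antisym zero)
    then show ?thesis
      using y by blast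
  qed
  then have "e ` ?Q = e ` ({..<k} \<rightarrow> {0..L})"
    by (auto simp: PiE_iff Pi_iff)
  ultimately show ?thesis
    by simp
qed

text \<open>In a cube of dimension \<open>k = m + 1\<close>, the finite cover to be refined has one member
  \<open>U S\<close> for each set \<open>S\<close> of coordinates; it avoids the lower faces for the coordinates in \<open>S\<close> and the upper faces for the others. Opposite faces have
  disjoint closures, so these sets cover the space, and none of them meets two
  opposite faces. A refinement then colours a fine grid as in \<open>grid_colouring\<close>; when the colour of a
  grid point contains a ball around it that includes all its neighbours, every
  vertex of the cell that is found lies in \<open>k + 1\<close> members.\<close>

lemma not_covering_dim_le_cube:
  assumes e: "cube_embedding (Suc m) 1 e"
  shows "\<not> covering_dim_le mtopology m"
proof
  assume dim: "covering_dim_le mtopology m"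
  define k where "k = Suc m"
  note e = e[folded k_def]
  define Q :: "(nat \<Rightarrow> real) set" where "Q = {..<k} \<rightarrow> {0..1}"
  define F where "F = (\<lambda>i b. e ` {x \<in> Q. x i = b})"
  define U where "U = (\<lambda>S. M - (\<Union>i\<in>S. mtopology closure_of F i 0)
                             - (\<Union>i\<in>{..<k} - S. mtopology closure_of F i 1))"
  have FM: "F i b \<subseteq> M" for i b
    using cube_embeddingD(1)[OF e] by (auto simp: F_def Q_def)
  have disj: "mtopology closure_of F i 0 \<inter> mtopology closure_of F i 1 = {}" if "i < k" for i
  proof (rule ccontr)
    assume "\<not> ?thesis"
    then obtain z where z: "z \<in> mtopology closure_of F i 0" "z \<in> mtopology closure_of F i 1"
      by blast
    obtain u where u: "u \<in> F i 0" "u \<in> mball z (1/2)"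
      using z(1) half_gt_zero[OF zero_less_one] unfolding metric_closure_of mem_Collect_eq by blast
    obtain v where v: "v \<in> F i 1" "v \<in> mball z (1/2)"
      using z(2) half_gt_zero[OF zero_less_one] unfolding metric_closure_of mem_Collect_eq by blast
    obtain x where x: "x \<in> Q" "x i = 0" "e x \<in> mball z (1/2)"
      using u by (auto simp: F_def)
    obtain y where y: "y \<in> Q" "y i = 1" "e y \<in> mball z (1/2)"
      using v by (auto simp: F_def)
    have "1 \<le> d (e x) (e y)"
      using cube_embeddingD(2)[OF e, of x y i] x y that by (simp add: Q_def)
    also have "\<dots> \<le> d (e x) z + d z (e y)"
      using x y by (intro triangle) auto
    also have "\<dots> < 1"
      using x y by (auto simp: commute)
    finally show False by simp
  qed
  have "openin mtopology (U S)" if "S \<subseteq> {..<k}" for S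
  proof -
    have "closedin mtopology (\<Union>i\<in>S. mtopology closure_of F i 0)"
      using finite_subset[OF that] by (intro closedin_Union) auto
    moreover have "closedin mtopology (\<Union>i\<in>{..<k}-S. mtopology closure_of F i 1)"
      by (intro closedin_Union) auto
    ultimately show ?thesis
      unfolding U_def by (intro openin_diff) (auto simp: openin_diff)
  qed
  moreover have "\<Union> (U ` Pow {..<k}) = topspace mtopology"
  proof
    show "\<Union> (U ` Pow {..<k}) \<subseteq> topspace mtopology"
      by (auto simp: U_def)
    have "z \<in> U {i. i < k \<and> z \<notin> mtopology closure_of F i 0}" if "z \<in> M" for z
      using that disj by (auto simp: U_def)
    then show "topspace mtopology \<subseteq> \<Union> (U ` Pow {..<k})"
      by fastforce
  qed
  ultimately have cov: "finite (U ` Pow {..<k}) \<and> (\<forall>V\<in>U ` Pow {..<k}. openin mtopology V) \<and>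
      \<Union> (U ` Pow {..<k}) = topspace mtopology"
    by blast
  obtain \<V> where V: "\<forall>V\<in>\<V>. openin mtopology V" "\<Union>\<V> = topspace mtopology"
      "\<forall>V\<in>\<V>. \<exists>W\<in>U ` Pow {..<k}. V \<subseteq> W"
      "\<forall>x\<in>topspace mtopology. finite {V\<in>\<V>. x \<in> V} \<and> card {V\<in>\<V>. x \<in> V} \<le> m + 1"
    using dim[unfolded covering_dim_le_def, rule_format, OF cov] by (elim exE conjE)
  have \<V>: "\<And>V. V \<in> \<V> \<Longrightarrow> openin mtopology V" "\<Union>\<V> = M"
      "\<And>V. V \<in> \<V> \<Longrightarrow> \<exists>S. V \<subseteq> U S \<and> S \<subseteq> {..<k}"
      "\<And>x. x \<in> M \<Longrightarrow> finite {V\<in>\<V>. x \<in> V}" "\<And>x. x \<in> M \<Longrightarrow> card {V\<in>\<V>. x \<in> V} \<le> k"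
    using V(1,2) V(3) bspec[OF V(4)] by (simp_all add: k_def) blast
  have "e ` Q \<subseteq> \<Union>\<V>"
    using cube_embeddingD(1)[OF e] \<V>(2) by (auto simp: Q_def)
  then obtain \<epsilon> where \<epsilon>: "0 < \<epsilon>" "\<And>z. z \<in> e ` Q \<Longrightarrow> \<exists>V\<in>\<V>. mball z \<epsilon> \<subseteq> V"
    using lebesgue_number[of "e ` Q" \<V>] compactin_cube_embedding[OF e] \<V>(1)
    unfolding Q_def by metis
  obtain N :: nat where N: "0 < N" "real k * (1 / real N) < \<epsilon>"
  proof -
    obtain N :: nat where "real k / \<epsilon> < real N"
      using reals_Archimedean2 by blast
    moreover from this have "0 < N"
      using \<epsilon>(1) by (metis divide_nonneg_pos gr0I not_less of_nat_0 of_nat_0_le_iff)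
    ultimately show ?thesis
      using that \<epsilon>(1) by (simp add: field_simps)
  qed
  define g where "g = (\<lambda>(x :: nat \<Rightarrow> nat) (j :: nat). real (x j) / real N)"
  have gQ: "g x \<in> Q" if "\<And>j. x j \<le> N" for x :: "nat \<Rightarrow> nat"
    using that N(1) by (auto simp: g_def Q_def)
  \<comment> \<open>the colour of a grid point contains not just its image but an \<open>\<epsilon>\<close>-ball around the image\<close>
  define c where "c = (\<lambda>x. SOME V. V \<in> \<V> \<and> mball (e (g x)) \<epsilon> \<subseteq> V)"
  have c: "c x \<in> \<V>" "mball (e (g x)) \<epsilon> \<subseteq> c x" if "\<And>j. x j \<le> N" for x
    using someI_ex[of "\<lambda>V. V \<in> \<V> \<and> mball (e (g x)) \<epsilon> \<subseteq> V"] \<epsilon>(2)[of "e (g x)"] gQ[of x] that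
    unfolding c_def by blast+
  have self: "e (g x) \<in> c x" if "\<And>j. x j \<le> N" for x
    using c(2)[of x] that \<epsilon>(1) cube_embeddingD(1)[OF e gQ[unfolded Q_def]] by auto
  have opp: "c x \<noteq> c y"
    if xy: "\<And>j. x j \<le> N" "\<And>j. y j \<le> N" and i: "i < k" "x i = 0" "y i = N" for x y i
  proof
    assume eq: "c x = c y"
    obtain S where S: "c x \<subseteq> U S"
      using \<V>(3) c(1)[of x] xy by blast
    have "e (g x) \<in> F i 0" "e (g y) \<in> F i 1"
      using gQ[of x] gQ[of y] xy i N(1) by (auto simp: F_def g_def)
    then have "e (g x) \<in> mtopology closure_of F i 0" "e (g y) \<in> mtopology closure_of F i 1"
      using closure_of_subset[of "F i _" mtopology] FM by auto
    moreover have "e (g x) \<in> U S" "e (g y) \<in> U S"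
      using S self[of x] self[of y] xy eq by auto
    ultimately show False
      using i by (auto simp: U_def)
  qed
  obtain s where s: "finite s" "\<And>x j. x \<in> s \<Longrightarrow> x j \<le> N"
    "\<And>x y j. x \<in> s \<Longrightarrow> y \<in> s \<Longrightarrow> \<bar>real (x j) - real (y j)\<bar> \<le> 1" "k < card (c ` s)"
    using grid_colouring[of N k c] N(1) opp by blast
  then obtain w where w: "w \<in> s"
    by fastforce
  have wM: "e (g w) \<in> M"
    using cube_embeddingD(1)[OF e gQ[unfolded Q_def]] s(2)[OF w] by blast
  have "e (g w) \<in> c x" if x: "x \<in> s" for x
  proof -
    have "\<bar>g x i - g w i\<bar> \<le> 1 / real N" for i
      using s(3)[OF x w, of i] N(1) by (simp add: g_def field_simps flip: diff_divide_distrib)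
    then have "d (e (g x)) (e (g w)) \<le> real k * (1 / real N)"
      using cube_embeddingD(3)[OF e gQ[unfolded Q_def] gQ[unfolded Q_def]] s(2) x w by blast
    then have "e (g w) \<in> mball (e (g x)) \<epsilon>"
      using N(2) wM cube_embeddingD(1)[OF e gQ[unfolded Q_def]] s(2)[OF x] by auto
    then show ?thesis
      using c(2)[of x] s(2)[OF x] by blast
  qed
  then have "c ` s \<subseteq> {V\<in>\<V>. e (g w) \<in> V}"
    using c(1) s(2) by blast
  then have "card (c ` s) \<le> k"
    using order_trans[OF card_mono[OF \<V>(4)[OF wM]] \<V>(5)[OF wM]] by simp
  then show False
    using s(4) by simp
qed

text \<open>With \<open>k = m + 1\<close>, the scale \<open>R = k + 1\<close> is chosen before the cover, whose members may
  then have any uniform diameter bound \<open>D\<close>. A cube of edge \<open>N > D\<close> has no member meeting two of its opposite faces,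
  while the vertices of a cell of its integer grid stay at distance at most \<open>k < R\<close>.\<close>

lemma not_asymptotic_dim_le_cubes:
  assumes "\<And>L. 0 < L \<Longrightarrow> \<exists>e. cube_embedding (Suc m) L e"
  shows "\<not> asymptotic_dim_le m"
proof
  define k where "k = Suc m"
  assume dim: "asymptotic_dim_le m"
  have "(0::real) < real k + 1"
    by simp
  from dim[unfolded asymptotic_dim_le_def, rule_format, OF this]
  obtain \<U> D where \<U>: "\<Union>\<U> = M"
      and D0: "\<forall>U\<in>\<U>. \<forall>x\<in>U. \<forall>y\<in>U. d x y \<le> D"
      and mult0: "\<forall>x\<in>M. finite {U\<in>\<U>. U \<inter> mball x (real k + 1) \<noteq> {}} \<and>
        card {U\<in>\<U>. U \<inter> mball x (real k + 1) \<noteq> {}} \<le> m + 1"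
    by (elim exE conjE)
  have D: "\<And>U x y. \<lbrakk>U \<in> \<U>; x \<in> U; y \<in> U\<rbrakk> \<Longrightarrow> d x y \<le> D"
    using D0 by blast
  have mult: "\<And>x. x \<in> M \<Longrightarrow> finite {U\<in>\<U>. U \<inter> mball x (real k + 1) \<noteq> {}}"
        "\<And>x. x \<in> M \<Longrightarrow> card {U\<in>\<U>. U \<inter> mball x (real k + 1) \<noteq> {}} \<le> k"
    using bspec[OF mult0] by (simp_all add: k_def)
  obtain N :: nat where N: "max D 0 < real N"
    using reals_Archimedean2 by blast
  then have N0: "0 < N" by auto
  obtain e where e: "cube_embedding k (real N) e"
    using assms[of "real N"] N0 unfolding k_def by auto
  define g where "g = (\<lambda>(x :: nat \<Rightarrow> nat) (j :: nat). real (x j))"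
  have gQ: "g x \<in> {..<k} \<rightarrow> {0..real N}" if "\<And>j. x j \<le> N" for x
    using that by (auto simp: g_def)
  define c where "c = (\<lambda>x. SOME U. U \<in> \<U> \<and> e (g x) \<in> U)"
  have c: "c x \<in> \<U>" "e (g x) \<in> c x" if "\<And>j. x j \<le> N" for x
    using someI_ex[of "\<lambda>U. U \<in> \<U> \<and> e (g x) \<in> U"] cube_embeddingD(1)[OF e gQ[of x]] \<U> that
    unfolding c_def by blast+
  have opp: "c x \<noteq> c y"
    if xy: "\<And>j. x j \<le> N" "\<And>j. y j \<le> N" and i: "i < k" "x i = 0" "y i = N" for x y i
  proof
    assume "c x = c y"
    then have "d (e (g x)) (e (g y)) \<le> D"
      using D[OF c(1)[of x] c(2)[of x]] c(2)[of y] xy by auto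
    moreover have "real N \<le> d (e (g x)) (e (g y))"
      using cube_embeddingD(2)[OF e gQ[of x] gQ[of y] i(1)] xy i by (simp add: g_def)
    ultimately show False
      using N by simp
  qed
  obtain s where s: "finite s" "\<And>x j. x \<in> s \<Longrightarrow> x j \<le> N"
    "\<And>x y j. x \<in> s \<Longrightarrow> y \<in> s \<Longrightarrow> \<bar>real (x j) - real (y j)\<bar> \<le> 1" "k < card (c ` s)"
    using grid_colouring[of N k c] N0 opp by blast
  then obtain w where w: "w \<in> s"
    by fastforce
  have eM: "e (g x) \<in> M" if "x \<in> s" for x
    using cube_embeddingD(1)[OF e gQ] s(2)[OF that] by blast
  have "c x \<inter> mball (e (g w)) (real k + 1) \<noteq> {}" if x: "x \<in> s" for x
  proof -
    have "d (e (g w)) (e (g x)) \<le> real k * 1"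
      using cube_embeddingD(3)[OF e gQ gQ, of w x 1] s(2)[OF x] s(2)[OF w] s(3)[OF w x]
      by (simp add: g_def)
    then have "e (g x) \<in> mball (e (g w)) (real k + 1)"
      using eM x w by simp
    then show ?thesis
      using c(2)[of x] s(2)[OF x] by blast
  qed
  then have "c ` s \<subseteq> {U\<in>\<U>. U \<inter> mball (e (g w)) (real k + 1) \<noteq> {}}"
    using c(1) s(2) by blast
  then have "card (c ` s) \<le> k"
    using order_trans[OF card_mono[OF mult(1)[OF eM[OF w]]] mult(2)[OF eM[OF w]]] by simp
  then show False
    using s(4) by simp
qed

text \<open>A subset of diameter \<open>D \<le> 1\<close> pulls back to a subset of a box of edge \<open>2 * D\<close>, whose volume
  \<open>2 ^ k * D ^ k\<close> is at most \<open>2 ^ k * D powr s\<close>. Since the boxes of a cover exhaust the unit cube, the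
  sum of the \<open>D powr s\<close> is at least \<open>2 ^ - k\<close>.\<close>

lemma hausdorff_measure_cube_nonzero:
  assumes e: "cube_embedding k 1 e" and s: "0 < s" "s \<le> real k"
  shows "hausdorff_measure s M \<noteq> 0"
proof
  assume H: "hausdorff_measure s M = 0"
  have k: "0 < k"
    using s by (cases k) auto
  have "hausdorff_premeasure s 1 M \<le> hausdorff_measure s M"
    unfolding hausdorff_measure_def by (intro SUP_upper) auto
  also have "\<dots> < ennreal ((1/2) ^ k)"
    using H by simp
  finally obtain U where U: "\<And>i. U i \<subseteq> M" "\<And>i. mdiam (U i) \<le> 1" "M \<subseteq> (\<Union>i::nat. U i)"
      and sum: "(\<Sum>i. ennreal_rpow (mdiam (U i)) s) < ennreal ((1/2) ^ k)"
    unfolding hausdorff_premeasure_def INF_less_iff by auto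
  interpret finite_product_sigma_finite "\<lambda>_. lborel :: real measure" "{..<k}"
    by standard simp
  let ?V = "PiM {..<k} (\<lambda>_. lborel :: real measure)"
  define Q where "Q = {..<k} \<rightarrow>\<^sub>E {0..1::real}"
  have Qpi: "x \<in> {..<k} \<rightarrow> {0..1}" if "x \<in> Q" for x
    using that by (auto simp: Q_def)
  define D where "D = (\<lambda>i. enn2real (mdiam (U i)))"
  have D: "mdiam (U i) = ennreal (D i)" "0 \<le> D i" "D i \<le> 1" for i
  proof -
    show eq: "mdiam (U i) = ennreal (D i)"
      using U(2)[of i] unfolding D_def
      by (intro ennreal_enn2real[symmetric]) (metis ennreal_one_less_top order_le_less_trans)
    show "0 \<le> D i" by (simp add: D_def)
    show "D i \<le> 1"
      using U(2)[of i] unfolding eq by simp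
  qed
  have dD: "d x y \<le> D i" if "x \<in> U i" "y \<in> U i" for x y i
  proof -
    have "ennreal (d x y) \<le> mdiam (U i)"
      unfolding mdiam_def using that by (meson SUP_upper2 order_refl)
    then show ?thesis
      using D by simp
  qed
  \<comment> \<open>the centre of the box for \<open>U i\<close>; it is arbitrary when \<open>U i\<close> misses the cube\<close>
  define z where "z = (\<lambda>i. SOME x. x \<in> Q \<and> e x \<in> U i)"
  define B where "B = (\<lambda>i. PiE {..<k} (\<lambda>j. {z i j - D i..z i j + D i}))"
  have "Q \<subseteq> (\<Union>i. B i)"
  proof
    fix x assume x: "x \<in> Q"
    then obtain i where i: "e x \<in> U i"
      using U(3) cube_embeddingD(1)[OF e Qpi] by blast
    have zi: "z i \<in> Q" "e (z i) \<in> U i"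
      using someI[of "\<lambda>x. x \<in> Q \<and> e x \<in> U i" x] x i unfolding z_def by blast+
    have "\<bar>x j - z i j\<bar> \<le> D i" if "j < k" for j
      using cube_embeddingD(2)[OF e Qpi[OF x] Qpi[OF zi(1)] that] dD[OF i zi(2)] by simp
    then have "x \<in> B i"
      using x unfolding B_def Q_def PiE_iff by (fastforce simp: abs_le_iff)
    then show "x \<in> (\<Union>i. B i)" by blast
  qed
  moreover have B: "B i \<in> sets ?V" for i
    unfolding B_def by (intro sets_PiM_I_finite) auto
  ultimately have "emeasure ?V Q \<le> emeasure ?V (\<Union>i. B i)"
    by (intro emeasure_mono sets.countable_UN) auto
  also have "\<dots> \<le> (\<Sum>i. emeasure ?V (B i))"
    using B by (intro emeasure_subadditive_countably) auto
  also have "\<dots> \<le> (\<Sum>i. ennreal (2 ^ k) * ennreal_rpow (mdiam (U i)) s)"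
  proof (intro suminf_le summableI)
    fix i
    have "emeasure ?V (B i) = (\<Prod>j<k. emeasure lborel {z i j - D i..z i j + D i})"
      unfolding B_def by (intro measure_times) auto
    also have "\<dots> = (\<Prod>j<k. ennreal (2 * D i))"
      using D(2)[of i] by (intro prod.cong) auto
    also have "\<dots> = ennreal (2 ^ k * D i ^ k)"
      using D(2)[of i] by (simp add: ennreal_power power_mult_distrib)
    also have "\<dots> \<le> ennreal (2 ^ k * D i powr s)"
    proof -
      have "D i ^ k = D i powr real k"
        using D(2)[of i] k by (cases "D i = 0") (auto simp: powr_realpow)
      also have "\<dots> \<le> D i powr s"
        using D(2,3)[of i] s by (intro powr_mono') auto
      finally show ?thesis
        by (intro ennreal_leI mult_left_mono) auto
    qed
    also have "\<dots> = ennreal (2 ^ k) * ennreal_rpow (mdiam (U i)) s"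
      using D by (simp add: ennreal_rpow_def ennreal_mult)
    finally show "emeasure ?V (B i) \<le> ennreal (2 ^ k) * ennreal_rpow (mdiam (U i)) s" .
  qed
  also have "\<dots> = ennreal (2 ^ k) * (\<Sum>i. ennreal_rpow (mdiam (U i)) s)"
    by simp
  also have "\<dots> < ennreal (2 ^ k) * ennreal ((1/2) ^ k)"
    using sum by (intro ennreal_mult_strict_left_mono) auto
  also have "\<dots> = 1"
    by (simp flip: ennreal_mult power_mult_distrib)
  finally have "emeasure ?V Q < 1" .
  moreover have "emeasure ?V Q = (\<Prod>j<k. emeasure lborel {0..1::real})"
    unfolding Q_def by (intro measure_times) auto
  ultimately show False
    by simp
qed

theorem infinite_dimensions_if_cubes:
  assumes cubes: "\<And>k L. 0 < L \<Longrightarrow> \<exists>e. cube_embedding k L e"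
  shows "hausdorff_dim = \<infinity>" "covering_dim = \<infinity>" "asymptotic_dim = \<infinity>"
proof -
  have "hausdorff_measure s M \<noteq> 0" if s: "0 < s" for s
  proof -
    obtain k :: nat where "s \<le> real k"
      using real_arch_simple by blast
    then show ?thesis
      using cubes[of 1 k] hausdorff_measure_cube_nonzero s by auto
  qed
  then have empty: "{ennreal s | s. 0 < s \<and> hausdorff_measure s M = 0} = {}"
    by blast
  show "hausdorff_dim = \<infinity>"
    unfolding hausdorff_dim_def empty by simp
  have "\<not> covering_dim_le mtopology m" for m
    using cubes[of 1 "Suc m"] not_covering_dim_le_cube by auto
  then show "covering_dim = \<infinity>"
    by (simp add: covering_dim_def Inf_enat_def)
  have "\<not> asymptotic_dim_le m" for m
    using cubes not_asymptotic_dim_le_cubes by blast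
  then show "asymptotic_dim = \<infinity>"
    by (simp add: asymptotic_dim_def Inf_enat_def)
qed

end


section \<open>The metric on persistence diagrams\<close>

text \<open>Convexity of the power function at the convex combination of \<open>x / a\<close> and \<open>y / b\<close> with weights
  \<open>a / (a + b)\<close> and \<open>b / (a + b)\<close>. If the sums of
  the \<open>x powr p\<close> and of the \<open>y powr p\<close> are at most \<open>a powr p\<close> and \<open>b powr p\<close>, the sum of the right-hand
  sides is at most \<open>(a + b) powr p\<close>, because the weights add up to \<open>1\<close>.\<close>

lemma powr_add_le_weighted:
  fixes x y a b p :: real
  assumes "1 \<le> p" "0 \<le> x" "0 \<le> y" "0 < a" "0 < b"
  shows "(x + y) powr p \<le>
    (a + b) powr p * (a / (a + b)) / a powr p * x powr p +
    (a + b) powr p * (b / (a + b)) / b powr p * y powr p"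
proof -
  have convex: "((1 - t) * u + t * v) powr p \<le> (1 - t) * u powr p + t * v powr p"
    if t: "0 \<le> t" "t \<le> 1" and uv: "0 \<le> u" "0 \<le> v" for t u v :: real
  proof -
    have small: "l powr p \<le> l" if "0 \<le> l" "l \<le> 1" for l :: real
      using powr_mono'[of 1 p l] that \<open>1 \<le> p\<close> by (cases "l = 0") auto
    consider "u = 0" | "v = 0" | "0 < u" "0 < v"
      using uv by fastforce
    then show ?thesis
    proof cases
      case 1
      then show ?thesis
        using small[of t] t uv by (simp add: powr_mult mult_right_mono)
    next
      case 2
      then show ?thesis
        using small[of "1 - t"] t uv by (simp add: powr_mult mult_right_mono)
    next
      case 3
      then show ?thesis
        using convex_onD[OF powr_convex[OF \<open>1 \<le> p\<close>], of t u v] t by simp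
    qed
  qed
  let ?t = "b / (a + b)"
  have t: "1 - ?t = a / (a + b)"
    using assms by (simp add: field_simps)
  have "x + y = (a + b) * ((1 - ?t) * (x / a) + ?t * (y / b))"
    using assms unfolding t by (simp add: distrib_left)
  also have "\<dots> powr p = (a + b) powr p * ((1 - ?t) * (x / a) + ?t * (y / b)) powr p"
    by (rule powr_mult)
  also have "\<dots> \<le> (a + b) powr p * ((1 - ?t) * (x / a) powr p + ?t * (y / b) powr p)"
    using assms by (intro mult_left_mono convex) auto
  finally show ?thesis
    using assms unfolding t by (simp add: powr_divide algebra_simps)
qed

lemma infsum_ennreal_ge_term:
  fixes f :: "'b \<Rightarrow> ennreal"
  assumes "x \<in> S"
  shows "f x \<le> infsum f S"
proof -
  have "infsum f {x} \<le> infsum f S"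
    using assms by (intro infsum_mono_neutral nonneg_summable_on_complete) auto
  then show ?thesis by simp
qed

text \<open>With strict upper bounds \<open>a\<close> and \<open>b\<close> in place of the two norms, both bounds are positive and finite,
  so that the weights above make sense even if a norm vanishes.\<close>

lemma Minkowski_infsum_less:
  fixes f g :: "'b \<Rightarrow> real"
  assumes p: "1 \<le> p" and ab: "0 < a" "0 < b"
    and nonneg: "\<And>c. c \<in> S \<Longrightarrow> 0 \<le> f c" "\<And>c. c \<in> S \<Longrightarrow> 0 \<le> g c"
    and f: "(\<Sum>\<^sub>\<infinity>c\<in>S. ennreal (f c powr p)) < ennreal (a powr p)"
    and g: "(\<Sum>\<^sub>\<infinity>c\<in>S. ennreal (g c powr p)) < ennreal (b powr p)"
  shows "(\<Sum>\<^sub>\<infinity>c\<in>S. ennreal ((f c + g c) powr p)) < ennreal ((a + b) powr p)"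
proof -
  define A where "A = (a + b) powr p * (a / (a + b)) / a powr p"
  define B where "B = (a + b) powr p * (b / (a + b)) / b powr p"
  have AB: "0 < A" "0 < B"
    using ab by (simp_all add: A_def B_def)
  let ?f = "\<Sum>\<^sub>\<infinity>c\<in>S. ennreal (f c powr p)" and ?g = "\<Sum>\<^sub>\<infinity>c\<in>S. ennreal (g c powr p)"
  have "(\<Sum>\<^sub>\<infinity>c\<in>S. ennreal ((f c + g c) powr p)) \<le> ennreal A * ?f + ennreal B * ?g"
  proof (rule infsum_le_finite_sums)
    fix F assume F: "finite F" "F \<subseteq> S"
    have "(\<Sum>c\<in>F. ennreal ((f c + g c) powr p)) \<le>
        (\<Sum>c\<in>F. ennreal A * ennreal (f c powr p) + ennreal B * ennreal (g c powr p))"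
    proof (rule sum_mono)
      fix c assume "c \<in> F"
      then have "(f c + g c) powr p \<le> A * f c powr p + B * g c powr p"
        unfolding A_def B_def using F nonneg p ab by (intro powr_add_le_weighted) auto
      then show "ennreal ((f c + g c) powr p) \<le>
          ennreal A * ennreal (f c powr p) + ennreal B * ennreal (g c powr p)"
        using AB by (simp flip: ennreal_mult ennreal_plus)
    qed
    also have "\<dots> = ennreal A * (\<Sum>c\<in>F. ennreal (f c powr p)) +
        ennreal B * (\<Sum>c\<in>F. ennreal (g c powr p))"
      unfolding sum.distrib sum_distrib_left ..
    also have "\<dots> \<le> ennreal A * ?f + ennreal B * ?g"
    proof (intro add_mono mult_left_mono)
      have "sum h F \<le> infsum h S" for h :: "'b \<Rightarrow> ennreal"
        unfolding infsum_finite[OF F(1), symmetric] using F(2)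
        by (intro infsum_mono_neutral nonneg_summable_on_complete) auto
      then show "(\<Sum>c\<in>F. ennreal (f c powr p)) \<le> ?f" "(\<Sum>c\<in>F. ennreal (g c powr p)) \<le> ?g"
        by blast+
    qed auto
    finally show "(\<Sum>c\<in>F. ennreal ((f c + g c) powr p)) \<le> ennreal A * ?f + ennreal B * ?g" .
  qed (simp add: nonneg_summable_on_complete)
  also have "\<dots> < ennreal (A * a powr p + B * b powr p)"
  proof (rule add_mono_ennreal)
    show "ennreal A * ?f < ennreal (A * a powr p)" "ennreal B * ?g < ennreal (B * b powr p)"
      using AB f g by (auto simp: ennreal_mult intro!: ennreal_mult_strict_left_mono)
  qed
  also have "A * a powr p + B * b powr p = (a + b) powr p * (a / (a + b)) + (a + b) powr p * (b / (a + b))"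
    using ab by (simp add: A_def B_def)
  also have "(a + b) powr p * (a / (a + b)) + (a + b) powr p * (b / (a + b)) = (a + b) powr p"
    using ab by (simp flip: distrib_left add_divide_distrib)
  finally show ?thesis .
qed

text \<open>Inequalities between infima are reduced to strict real bounds, for which
  matchings can be chosen.\<close>

lemma ennreal_le_addI:
  fixes x y z :: ennreal
  assumes "\<And>a b. 0 < a \<Longrightarrow> 0 < b \<Longrightarrow> y < ennreal a \<Longrightarrow> z < ennreal b \<Longrightarrow> x \<le> ennreal (a + b)"
  shows "x \<le> y + z"
proof (rule ennreal_le_epsilon)
  fix e :: real assume e: "y + z < top" "0 < e"
  then obtain u v where uv: "y = ennreal u" "z = ennreal v" "0 \<le> u" "0 \<le> v"
    by (cases y; cases z) auto
  have "x \<le> ennreal ((u + e / 2) + (v + e / 2))"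
    using uv e by (intro assms) (auto intro!: ennreal_lessI)
  also have "\<dots> = y + z + ennreal e"
    using uv e by (simp flip: ennreal_plus)
  finally show "x \<le> y + z + ennreal e" .
qed

definition match_cost where
  "match_cost p s \<phi> = (\<Sum>\<^sub>\<infinity>c\<in>copies s. ennreal (dist (fst c) (fst (\<phi> c)) powr p))"

lemma matching_dist_less_iff:
  assumes "1 \<le> p" "0 < r"
  shows "matching_dist p s t < ennreal r \<longleftrightarrow>
    (\<exists>\<phi>. bij_betw \<phi> (copies s) (copies t) \<and> match_cost p s \<phi> < ennreal (r powr p))"
proof -
  have "ennreal_rpow C (1 / p) < ennreal r \<longleftrightarrow> C < ennreal (r powr p)" for C
  proof (cases C)
    case (real c)
    have "c powr (1 / p) < r \<longleftrightarrow> c < r powr p"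
      using powr_less_mono2[of p "c powr (1 / p)" r] powr_mono2[of p r "c powr (1 / p)"]
        assms real by (cases "c = 0") (fastforce simp: powr_powr not_less[symmetric])+
    then show ?thesis
      using assms real by (auto simp: ennreal_rpow_def ennreal_less_iff)
  qed (simp add: ennreal_rpow_def)
  then show ?thesis
    unfolding matching_dist_def match_cost_def by (simp add: INF_less_iff)
qed

text \<open>Matchings compose, and the displacements of the composite are bounded by the sums of the
  displacements, to which Minkowski's inequality applies.\<close>

lemma matching_dist_triangle:
  assumes "1 \<le> p"
  shows "matching_dist p s u \<le> matching_dist p s t + matching_dist p t u"
proof (rule ennreal_le_addI)
  fix a b :: real assume ab: "0 < a" "0 < b" "matching_dist p s t < ennreal a" "matching_dist p t u < ennreal b"
  then obtain \<phi> \<psi> where \<phi>: "bij_betw \<phi> (copies s) (copies t)" "match_cost p s \<phi> < ennreal (a powr p)"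
    and \<psi>: "bij_betw \<psi> (copies t) (copies u)" "match_cost p t \<psi> < ennreal (b powr p)"
    using assms by (auto simp: matching_dist_less_iff)
  have "match_cost p t \<psi> = (\<Sum>\<^sub>\<infinity>c\<in>copies s. ennreal (dist (fst (\<phi> c)) (fst (\<psi> (\<phi> c))) powr p))"
    unfolding match_cost_def by (rule infsum_reindex_bij_betw[OF \<phi>(1), symmetric])
  then have "(\<Sum>\<^sub>\<infinity>c\<in>copies s. ennreal ((dist (fst c) (fst (\<phi> c)) +
      dist (fst (\<phi> c)) (fst (\<psi> (\<phi> c)))) powr p)) < ennreal ((a + b) powr p)"
    using \<phi>(2) \<psi>(2) assms ab unfolding match_cost_def by (intro Minkowski_infsum_less) auto
  moreover have "match_cost p s (\<psi> \<circ> \<phi>) \<le> (\<Sum>\<^sub>\<infinity>c\<in>copies s. ennreal ((dist (fst c) (fst (\<phi> c)) +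
      dist (fst (\<phi> c)) (fst (\<psi> (\<phi> c)))) powr p))"
    unfolding match_cost_def using assms
    by (intro infsum_mono nonneg_summable_on_complete)
      (auto intro!: ennreal_leI powr_mono2 dist_triangle)
  ultimately have "match_cost p s (\<psi> \<circ> \<phi>) < ennreal ((a + b) powr p)"
    by (rule order_le_less_trans[rotated])
  then have "matching_dist p s u < ennreal (a + b)"
    using bij_betw_trans[OF \<phi>(1) \<psi>(1)] ab(1,2) matching_dist_less_iff[OF assms, of "a + b" s u]
    by (metis add_pos_pos)
  then show "matching_dist p s u \<le> ennreal (a + b)"
    by simp
qed

lemma matching_dist_sym: "matching_dist p s t = matching_dist p t s"
proof -
  have "matching_dist p t s \<le> matching_dist p s t" for s t :: "'a cmset"
    unfolding matching_dist_def
  proof (rule INF_mono)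
    fix \<phi> assume "\<phi> \<in> {\<phi>. bij_betw \<phi> (copies s) (copies t)}"
    then have \<phi>: "bij_betw \<phi> (copies s) (copies t)" by simp
    let ?\<psi> = "inv_into (copies s) \<phi>"
    have "(\<Sum>\<^sub>\<infinity>c\<in>copies t. ennreal (dist (fst c) (fst (?\<psi> c)) powr p)) =
        (\<Sum>\<^sub>\<infinity>c\<in>copies s. ennreal (dist (fst (\<phi> c)) (fst (?\<psi> (\<phi> c))) powr p))"
      by (rule infsum_reindex_bij_betw[OF \<phi>, symmetric])
    also have "\<dots> = (\<Sum>\<^sub>\<infinity>c\<in>copies s. ennreal (dist (fst c) (fst (\<phi> c)) powr p))"
      using bij_betw_inv_into_left[OF \<phi>] by (intro infsum_cong) (simp add: dist_commute)
    finally show "\<exists>\<psi>\<in>{\<psi>. bij_betw \<psi> (copies t) (copies s)}.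
        ennreal_rpow (\<Sum>\<^sub>\<infinity>c\<in>copies t. ennreal (dist (fst c) (fst (\<psi> c)) powr p)) (1 / p)
        \<le> ennreal_rpow (\<Sum>\<^sub>\<infinity>c\<in>copies s. ennreal (dist (fst c) (fst (\<phi> c)) powr p)) (1 / p)"
      using bij_betw_inv_into[OF \<phi>] by (intro bexI[of _ ?\<psi>]) simp_all
  qed
  then show ?thesis
    by (intro antisym)
qed

lemma rep_dist_le_matching_dist:
  "\<alpha> \<in> cmsets A \<Longrightarrow> \<beta> \<in> cmsets A \<Longrightarrow> rep_dist p A s t \<le> matching_dist p (s + \<alpha>) (t + \<beta>)"
  unfolding rep_dist_def by (intro INF_lower2[of \<alpha>] INF_lower)

lemma rep_dist_sym: "rep_dist p A s t = rep_dist p A t s"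
  unfolding rep_dist_def by (subst INF_commute) (simp add: matching_dist_sym)

text \<open>The two given matchings meet in \<open>t\<close> with different multisets \<open>\<beta>\<close> and \<open>\<gamma>\<close> on \<open>A\<close> added. Adding \<open>\<gamma>\<close> to
  both ends of the first and \<open>\<beta>\<close> to both ends of the second makes them composable, and does not increase
  the cost.\<close>

lemma rep_dist_triangle:
  assumes "1 \<le> p"
  shows "rep_dist p A s u \<le> rep_dist p A s t + rep_dist p A t u"
proof (rule ennreal_le_addI)
  fix a b :: real assume ab: "0 < a" "0 < b" "rep_dist p A s t < ennreal a" "rep_dist p A t u < ennreal b"
  obtain \<alpha> \<beta> where 1: "\<alpha> \<in> cmsets A" "\<beta> \<in> cmsets A" "matching_dist p (s + \<alpha>) (t + \<beta>) < ennreal a"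
    using ab(3) unfolding rep_dist_def INF_less_iff by blast
  obtain \<gamma> \<delta> where 2: "\<gamma> \<in> cmsets A" "\<delta> \<in> cmsets A" "matching_dist p (t + \<gamma>) (u + \<delta>) < ennreal b"
    using ab(4) unfolding rep_dist_def INF_less_iff by blast
  have "rep_dist p A s u \<le> matching_dist p (s + (\<alpha> + \<gamma>)) (u + (\<delta> + \<beta>))"
    using 1 2 by (intro rep_dist_le_matching_dist cmsets_add)
  also have "\<dots> \<le> matching_dist p (s + (\<alpha> + \<gamma>)) (t + (\<beta> + \<gamma>)) +
      matching_dist p (t + (\<beta> + \<gamma>)) (u + (\<delta> + \<beta>))"
    using assms by (rule matching_dist_triangle)
  also have "\<dots> \<le> matching_dist p (s + \<alpha>) (t + \<beta>) + matching_dist p (t + \<gamma>) (u + \<delta>)"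
    using matching_dist_add_le[of p "s + \<alpha>" \<gamma> "t + \<beta>"] matching_dist_add_le[of p "t + \<gamma>" \<beta> "u + \<delta>"]
    by (intro add_mono) (simp_all add: ac_simps)
  also have "\<dots> \<le> ennreal (a + b)"
    using 1(3) 2(3) ab by (simp add: add_mono less_imp_le)
  finally show "rep_dist p A s u \<le> ennreal (a + b)" .
qed

lemma rep_dist_less_iff:
  assumes "1 \<le> p" "0 < r"
  shows "rep_dist p A s t < ennreal r \<longleftrightarrow>
    (\<exists>\<alpha>\<in>cmsets A. \<exists>\<beta>\<in>cmsets A. \<exists>\<phi>. bij_betw \<phi> (copies (s + \<alpha>)) (copies (t + \<beta>)) \<and>
       match_cost p (s + \<alpha>) \<phi> < ennreal (r powr p))"
  unfolding rep_dist_def INF_less_iff matching_dist_less_iff[OF assms] by blast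

lemma match_cost_ge_dist:
  assumes "1 \<le> p" "c \<in> copies s" "match_cost p s \<phi> < ennreal (r powr p)" "0 < r"
  shows "dist (fst c) (fst (\<phi> c)) < r"
proof -
  have "ennreal (dist (fst c) (fst (\<phi> c)) powr p) < ennreal (r powr p)"
    using infsum_ennreal_ge_term[OF assms(2), of "\<lambda>c. ennreal (dist (fst c) (fst (\<phi> c)) powr p)"]
      assms(3) unfolding match_cost_def by (rule order_le_less_trans)
  then show ?thesis
    using powr_mono2[of p r "dist (fst c) (fst (\<phi> c))"] assms(1,4)
    by (fastforce simp: ennreal_less_iff not_less[symmetric])
qed

lemma copies_add_mono: "copies s \<subseteq> copies (s + t)"
proof -
  have "s x \<le> (s + t) x" for x
    by simp
  then show ?thesis
    by (auto simp: copies_def intro: order_less_le_trans)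
qed

lemma cmsets_outside: "\<alpha> \<in> cmsets A \<Longrightarrow> x \<notin> A \<Longrightarrow> \<alpha> x = 0"
  by (auto simp: cmsets_def)

lemma fst_copies_0_add: "\<beta> \<in> cmsets A \<Longrightarrow> c \<in> copies (0 + \<beta>) \<Longrightarrow> fst c \<in> A"
  by (cases c) (auto simp: copies_def cmsets_def)

text \<open>In a matching with a multiset on \<open>A\<close>, each point of \<open>s\<close> within \<open>r\<close> of \<open>x\<close> is moved by at least \<open>r\<close>;
  infinitely many of them would cost an infinite amount.\<close>

lemma finite_copies_near:
  assumes p: "1 \<le> p" and fin: "rep_dist p A s 0 < \<infinity>"
    and r: "0 < r" "\<And>a. a \<in> A \<Longrightarrow> 2 * r \<le> dist x a"
  shows "finite {c \<in> copies s. dist x (fst c) < r}"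
proof (rule ccontr)
  assume inf: "infinite {c \<in> copies s. dist x (fst c) < r}"
  obtain R where R: "0 < R" "rep_dist p A s 0 < ennreal R"
  proof (cases "rep_dist p A s 0")
    case (real q)
    then show ?thesis
      using that[of "q + 1"] by (auto intro!: ennreal_lessI)
  qed (use fin in simp)
  then obtain \<alpha> \<beta> \<phi> where m: "\<beta> \<in> cmsets A" "bij_betw \<phi> (copies (s + \<alpha>)) (copies (0 + \<beta>))"
      "match_cost p (s + \<alpha>) \<phi> < ennreal (R powr p)"
    using p by (auto simp: rep_dist_less_iff)
  let ?T = "{c \<in> copies (s + \<alpha>). dist x (fst c) < r}"
  let ?f = "\<lambda>c. ennreal (dist (fst c) (fst (\<phi> c)) powr p)"
  have "{c \<in> copies s. dist x (fst c) < r} \<subseteq> ?T"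
    using copies_add_mono[of s \<alpha>] by auto
  then have "infinite ?T"
    using inf finite_subset by blast
  moreover have "ennreal (r powr p) \<le> ?f c" if c: "c \<in> ?T" for c
  proof -
    have "fst (\<phi> c) \<in> A"
      using fst_copies_0_add[OF m(1)] bij_betwE[OF m(2)] c by blast
    then have "2 * r \<le> dist x (fst (\<phi> c))"
      by (rule r(2))
    also have "\<dots> \<le> dist x (fst c) + dist (fst c) (fst (\<phi> c))"
      by (rule dist_triangle)
    finally have "r \<le> dist (fst c) (fst (\<phi> c))"
      using c by simp
    then show ?thesis
      using p r(1) by (intro ennreal_leI powr_mono2) auto
  qed
  ultimately have "infsum ?f ?T = \<infinity>"
    using r(1) by (intro infsum_superconst_infinite_ennreal[where b = "ennreal (r powr p)"]) simp_all
  moreover have "infsum ?f ?T \<le> match_cost p (s + \<alpha>) \<phi>"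
    unfolding match_cost_def by (intro infsum_mono_neutral nonneg_summable_on_complete) auto
  ultimately show False
    using m(3) by (simp add: top_unique)
qed

text \<open>The point \<open>x\<close> has a neighbourhood that contains no point of \<open>A\<close> and no point of \<open>t\<close> except
  possibly \<open>x\<close> itself. A matching of sufficiently small cost has to send copies of \<open>x\<close> to copies
  of \<open>x\<close>, injectively.\<close>

lemma multiplicity_le_of_rep_dist_0:
  assumes p: "1 \<le> p" and A: "closed A" "x \<notin> A"
    and zero: "rep_dist p A s t = 0" and fin: "rep_dist p A t 0 < \<infinity>"
  shows "s x \<le> t x"
proof (rule ccontr)
  assume "\<not> ?thesis"
  then obtain n where n: "t x = enat n" "enat n < s x"
    by (cases "t x") auto
  obtain q where q: "0 < q" "ball x q \<subseteq> - A"
    using A open_contains_ball[of "- A"] by auto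
  define r where "r = q / 2"
  have r: "0 < r" "\<And>a. a \<in> A \<Longrightarrow> 2 * r \<le> dist x a"
    using q by (auto simp: r_def subset_iff not_less[symmetric])
  define T where "T = {c \<in> copies t. dist x (fst c) < r}"
  have "finite (fst ` T)"
    unfolding T_def using finite_copies_near[OF p fin r] by blast
  then obtain d where d: "0 < d" "\<And>y. y \<in> fst ` T \<Longrightarrow> y \<noteq> x \<Longrightarrow> d \<le> dist x y"
    using finite_set_avoid by metis
  define \<delta> where "\<delta> = min d r"
  have \<delta>: "0 < \<delta>" using d r by (simp add: \<delta>_def)
  then have "rep_dist p A s t < ennreal \<delta>"
    using zero by simp
  then obtain \<alpha> \<beta> \<phi> where m: "\<beta> \<in> cmsets A" "bij_betw \<phi> (copies (s + \<alpha>)) (copies (t + \<beta>))"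
      "match_cost p (s + \<alpha>) \<phi> < ennreal (\<delta> powr p)"
    using p \<delta> by (auto simp: rep_dist_less_iff)
  \<comment> \<open>one copy more than \<open>t\<close> has, all of them present in \<open>s\<close>\<close>
  let ?C = "Pair x ` {..n}"
  have C: "?C \<subseteq> copies (s + \<alpha>)"
  proof -
    have "?C \<subseteq> copies s"
      using n(2) by (auto simp: copies_def intro: order_le_less_trans[of _ "enat n"])
    then show ?thesis
      using copies_add_mono by blast
  qed
  have "\<phi> c \<in> Pair x ` {..<n}" if c: "c \<in> ?C" for c
  proof -
    have near: "dist x (fst (\<phi> c)) < \<delta>"
      using match_cost_ge_dist[OF p _ m(3) \<delta>, of c] C c by auto
    then have "fst (\<phi> c) \<notin> A"
      using r by (force simp: \<delta>_def)
    moreover have "\<phi> c \<in> copies (t + \<beta>)"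
      using bij_betwE[OF m(2)] C c by blast
    ultimately have copy: "\<phi> c \<in> copies t"
      using cmsets_outside[OF m(1)] by (auto simp: copies_def)
    then have "\<phi> c \<in> T"
      using near by (simp add: T_def \<delta>_def)
    then have "fst (\<phi> c) = x"
      using d(2)[of "fst (\<phi> c)"] near by (force simp: \<delta>_def)
    then show ?thesis
      using copy n(1) by (cases "\<phi> c") (auto simp: copies_def)
  qed
  then have "\<phi> ` ?C \<subseteq> Pair x ` {..<n}"
    by blast
  moreover have "inj_on \<phi> ?C"
    using m(2) C by (meson bij_betw_imp_inj_on inj_on_subset)
  ultimately have "card ?C \<le> card (Pair x ` {..<n})"
    by (intro card_inj_on_le) auto
  then show False
    by (simp add: card_image inj_on_def)
qed

lemma dgm_rel_if_eq_outside:
  assumes "s \<in> cmsets X" "t \<in> cmsets X" "\<And>x. x \<notin> A \<Longrightarrow> s x = t x"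
  shows "(s, t) \<in> dgm_rel X A"
proof -
  have "(\<lambda>x. if x \<in> A then u x else 0) \<in> cmsets A" if "u \<in> cmsets X" for u :: "'a cmset"
  proof -
    have "countable {x. (if x \<in> A then u x else 0) \<noteq> 0}"
      by (rule countable_subset[of _ "{x. u x \<noteq> 0}"]) (use that in \<open>auto simp: cmsets_def\<close>)
    then show ?thesis
      by (auto simp: cmsets_def)
  qed
  moreover have "s + (\<lambda>x. if x \<in> A then t x else 0) = t + (\<lambda>x. if x \<in> A then s x else 0)"
    using assms(3) by (auto simp: fun_eq_iff add.commute)
  ultimately show ?thesis
    using assms unfolding dgm_rel_def by blast
qed

lemma dgm_space_cases:
  assumes "\<sigma> \<in> dgm_space p X A"
  obtains s where "s \<in> cmsets X" "\<sigma> = dgm_rel X A `` {s}" "rep_dist p A s 0 < \<infinity>"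
proof -
  obtain s where s: "s \<in> cmsets X" "\<sigma> = dgm_rel X A `` {s}"
    using assms by (auto simp: dgm_space_def dgms_def elim: quotientE)
  moreover have "rep_dist p A s 0 < \<infinity>"
    using assms dgm_dist_class[OF s(1) cmsets_0] s(2) by (simp add: dgm_space_def empty_dgm_def)
  ultimately show ?thesis
    by (rule that)
qed

lemma dgm_space_classI:
  assumes "s \<in> cmsets X" "rep_dist p A s 0 < \<infinity>"
  shows "dgm_rel X A `` {s} \<in> dgm_space p X A"
  using assms dgm_dist_class[OF assms(1) cmsets_0]
  by (auto simp: dgm_space_def dgms_def empty_dgm_def quotientI)

lemma rep_dist_finite:
  assumes "1 \<le> p" "rep_dist p A s 0 < \<infinity>" "rep_dist p A t 0 < \<infinity>"
  shows "rep_dist p A s t < \<infinity>"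
proof -
  have "rep_dist p A s t \<le> rep_dist p A s 0 + rep_dist p A 0 t"
    by (rule rep_dist_triangle[OF assms(1)])
  also have "\<dots> < \<infinity>"
    using assms by (simp add: rep_dist_sym[of p A 0 t])
  finally show ?thesis .
qed

lemma rep_dist_eq_0_if_rel:
  assumes "(s, t) \<in> dgm_rel X A" "1 \<le> p"
  shows "rep_dist p A s t = 0"
proof -
  obtain \<alpha> \<beta> where ab: "\<alpha> \<in> cmsets A" "\<beta> \<in> cmsets A" "s + \<alpha> = t + \<beta>"
    using assms by (auto simp: dgm_rel_def)
  have "matching_dist p (t + \<beta>) (t + \<beta>) \<le> ennreal_rpow 0 (1 / p)"
    unfolding matching_dist_def by (rule INF_lower2[of id]) auto
  then show ?thesis
    using rep_dist_le_matching_dist[OF ab(1,2), of p s t] unfolding ab(3)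
    by (simp add: ennreal_rpow_def)
qed

text \<open>Closedness of \<open>A\<close> is what separates points: it keeps a point off \<open>A\<close> at a positive distance
  from all points that may be added freely.\<close>

theorem Metric_space_dgm_space:
  assumes p: "1 \<le> p" and A: "closed A"
  shows "Metric_space (dgm_space p X A) (dgm_mdist p A)"
proof
  show "0 \<le> dgm_mdist p A \<sigma> \<tau>" for \<sigma> \<tau>
    by (simp add: dgm_mdist_def)
  show "dgm_mdist p A \<sigma> \<tau> = dgm_mdist p A \<tau> \<sigma>" for \<sigma> \<tau>
    by (simp add: dgm_mdist_def dgm_dist_def rep_dist_sym)
next
  fix \<sigma> \<tau> assume "\<sigma> \<in> dgm_space p X A" "\<tau> \<in> dgm_space p X A"
  then obtain s t where s: "s \<in> cmsets X" "\<sigma> = dgm_rel X A `` {s}" "rep_dist p A s 0 < \<infinity>"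
      and t: "t \<in> cmsets X" "\<tau> = dgm_rel X A `` {t}" "rep_dist p A t 0 < \<infinity>"
    by (elim dgm_space_cases)
  have dist: "dgm_mdist p A \<sigma> \<tau> = enn2real (rep_dist p A s t)"
    by (simp add: dgm_mdist_def s t dgm_dist_class)
  show "dgm_mdist p A \<sigma> \<tau> = 0 \<longleftrightarrow> \<sigma> = \<tau>"
  proof
    assume "dgm_mdist p A \<sigma> \<tau> = 0"
    then have "rep_dist p A s t = 0"
      using rep_dist_finite[OF p s(3) t(3)] by (auto simp: dist enn2real_eq_0_iff)
    then have "s x = t x" if "x \<notin> A" for x
      using multiplicity_le_of_rep_dist_0[OF p A that] s(3) t(3) rep_dist_sym[of p A s t]
      by (metis order_antisym)
    then have "(s, t) \<in> dgm_rel X A"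
      by (rule dgm_rel_if_eq_outside[OF s(1) t(1)])
    then show "\<sigma> = \<tau>"
      using s t by (metis equiv_class_eq equiv_dgm_rel)
  next
    assume "\<sigma> = \<tau>"
    then have "(s, t) \<in> dgm_rel X A"
      using s t eq_equiv_class[OF _ equiv_dgm_rel] by metis
    then show "dgm_mdist p A \<sigma> \<tau> = 0"
      using rep_dist_eq_0_if_rel[of s t X A p] p by (simp add: dist)
  qed
next
  fix \<sigma> \<tau> \<upsilon>
  assume "\<sigma> \<in> dgm_space p X A" "\<tau> \<in> dgm_space p X A" "\<upsilon> \<in> dgm_space p X A"
  then obtain s t u where s: "s \<in> cmsets X" "\<sigma> = dgm_rel X A `` {s}" "rep_dist p A s 0 < \<infinity>"
      and t: "t \<in> cmsets X" "\<tau> = dgm_rel X A `` {t}" "rep_dist p A t 0 < \<infinity>"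
      and u: "u \<in> cmsets X" "\<upsilon> = dgm_rel X A `` {u}" "rep_dist p A u 0 < \<infinity>"
    by (elim dgm_space_cases)
  have fin: "rep_dist p A s t < \<infinity>" "rep_dist p A t u < \<infinity>"
    using rep_dist_finite[OF p] s t u by blast+
  have "enn2real (rep_dist p A s u) \<le> enn2real (rep_dist p A s t + rep_dist p A t u)"
    using rep_dist_triangle[OF p] fin by (intro enn2real_mono) auto
  also have "\<dots> = enn2real (rep_dist p A s t) + enn2real (rep_dist p A t u)"
    using fin by (intro enn2real_plus) auto
  finally show "dgm_mdist p A \<sigma> \<upsilon> \<le> dgm_mdist p A \<sigma> \<tau> + dgm_mdist p A \<tau> \<upsilon>"
    by (simp add: dgm_mdist_def s t u dgm_dist_class)
qed


section \<open>Cubes of diagrams along a ray\<close>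

definition set_cmset :: "'a set \<Rightarrow> 'a cmset" where
  "set_cmset P = (\<lambda>x. if x \<in> P then 1 else 0)"

lemma copies_set_cmset: "copies (set_cmset P) = (\<lambda>x. (x, 0)) ` P"
  by (auto simp: copies_def set_cmset_def one_enat_def zero_enat_def split: if_splits)

lemma set_cmset_in_cmsets: "finite P \<Longrightarrow> P \<subseteq> X \<Longrightarrow> set_cmset P \<in> cmsets X"
  by (auto simp: cmsets_def set_cmset_def intro: countable_finite)

lemma match_cost_finite: "finite (copies s) \<Longrightarrow> match_cost p s \<phi> < \<infinity>"
  by (simp add: match_cost_def ennreal_sum_less_top)

lemma matching_dist_le:
  assumes "1 \<le> p" "bij_betw \<phi> (copies s) (copies t)" "match_cost p s \<phi> \<le> ennreal (r powr p)" "0 \<le> r"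
  shows "matching_dist p s t \<le> ennreal r"
proof -
  have "ennreal_rpow (match_cost p s \<phi>) (1 / p) \<le> ennreal r"
  proof (cases "match_cost p s \<phi>")
    case (real c)
    then have "c \<le> r powr p"
      using assms(3) by (simp add: ennreal_le_iff)
    then have "c powr (1 / p) \<le> (r powr p) powr (1 / p)"
      using real assms(1) by (intro powr_mono2) auto
    then show ?thesis
      using assms real by (simp add: ennreal_rpow_def powr_powr)
  qed (use assms(3) in \<open>simp add: top_unique\<close>)
  moreover have "matching_dist p s t \<le> ennreal_rpow (match_cost p s \<phi>) (1 / p)"
    unfolding matching_dist_def match_cost_def using assms(2) by (intro INF_lower) simp
  ultimately show ?thesis
    by (rule order_trans[rotated])
qed

text \<open>The matching sends \<open>a i\<close> to \<open>b i\<close>. Its cost is at most \<open>card I * \<delta> powr p\<close>, and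
  \<open>card I \<le> card I powr p\<close> because \<open>p \<ge> 1\<close>.\<close>

lemma matching_dist_set_cmset_le:
  assumes p: "1 \<le> p" and inj: "inj_on a I" "inj_on b I" and I: "finite I"
    and close: "\<And>i. i \<in> I \<Longrightarrow> dist (a i) (b i) \<le> \<delta>" and \<delta>: "0 \<le> \<delta>"
  shows "matching_dist p (set_cmset (a ` I)) (set_cmset (b ` I)) \<le> ennreal (real (card I) * \<delta>)"
proof (rule matching_dist_le[OF p])
  let ?a = "\<lambda>i. (a i, 0 :: nat)" and ?b = "\<lambda>i. (b i, 0 :: nat)"
  define \<phi> where "\<phi> = ?b \<circ> inv_into I ?a"
  have a: "bij_betw ?a I (copies (set_cmset (a ` I)))"
    and b: "bij_betw ?b I (copies (set_cmset (b ` I)))"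
    using inj by (auto simp: copies_set_cmset bij_betw_def inj_on_def image_image)
  show "bij_betw \<phi> (copies (set_cmset (a ` I))) (copies (set_cmset (b ` I)))"
    unfolding \<phi>_def by (rule bij_betw_trans[OF bij_betw_inv_into[OF a] b])
  have "match_cost p (set_cmset (a ` I)) \<phi> =
      (\<Sum>\<^sub>\<infinity>i\<in>I. ennreal (dist (fst (?a i)) (fst (\<phi> (?a i))) powr p))"
    unfolding match_cost_def by (rule infsum_reindex_bij_betw[OF a, symmetric])
  also have "\<dots> = (\<Sum>i\<in>I. ennreal (dist (a i) (b i) powr p))"
    using I bij_betw_inv_into_left[OF a] by (auto simp: \<phi>_def intro!: sum.cong)
  also have "\<dots> \<le> (\<Sum>i\<in>I. ennreal (\<delta> powr p))"
    using close p by (intro sum_mono ennreal_leI powr_mono2) auto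
  also have "\<dots> = ennreal (real (card I) * \<delta> powr p)"
    by (simp add: ennreal_mult ennreal_of_nat_eq_real_of_nat)
  also have "\<dots> \<le> ennreal ((real (card I) * \<delta>) powr p)"
  proof -
    have "real (card I) \<le> real (card I) powr p"
      using powr_mono[of 1 p "real (card I)"] p by (cases "card I = 0") auto
    then show ?thesis
      using \<delta> by (intro ennreal_leI) (simp add: powr_mult mult_right_mono)
  qed
  finally show "match_cost p (set_cmset (a ` I)) \<phi> \<le> ennreal ((real (card I) * \<delta>) powr p)" .
qed (use \<delta> in simp)

text \<open>A single point of the first diagram that is far from the second diagram and from \<open>A\<close> already
  bounds the cost of every matching from below.\<close>

lemma rep_dist_set_cmset_ge:
  assumes p: "1 \<le> p" and x: "x \<in> P" and far: "\<And>y. y \<in> Q \<union> A \<Longrightarrow> r \<le> dist x y"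
  shows "ennreal r \<le> rep_dist p A (set_cmset P) (set_cmset Q)"
proof (rule ccontr)
  assume "\<not> ?thesis"
  then have less: "rep_dist p A (set_cmset P) (set_cmset Q) < ennreal r"
    by simp
  then have r: "0 < r"
    using ennreal_neg[of r] by (force simp: not_less[symmetric])
  obtain \<alpha> \<beta> \<phi> where m: "\<beta> \<in> cmsets A"
      "bij_betw \<phi> (copies (set_cmset P + \<alpha>)) (copies (set_cmset Q + \<beta>))"
      "match_cost p (set_cmset P + \<alpha>) \<phi> < ennreal (r powr p)"
    using less p r by (auto simp: rep_dist_less_iff)
  have c: "(x, 0) \<in> copies (set_cmset P + \<alpha>)"
    using copies_add_mono[of "set_cmset P" \<alpha>] x by (auto simp: copies_set_cmset)
  then have "\<phi> (x, 0) \<in> copies (set_cmset Q + \<beta>)"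
    using bij_betwE[OF m(2)] by blast
  then have "fst (\<phi> (x, 0)) \<in> Q \<union> A"
    using cmsets_outside[OF m(1), of "fst (\<phi> (x, 0))"]
    by (auto simp: copies_def set_cmset_def split: if_splits)
  then show False
    using far match_cost_ge_dist[OF p c m(3) r] by fastforce
qed

text \<open>A finite diagram is matched with as many copies of a single point of \<open>A\<close>.\<close>

lemma rep_dist_set_cmset_0:
  assumes p: "1 \<le> p" and P: "finite P" and a: "a \<in> A"
  shows "rep_dist p A (set_cmset P) 0 < \<infinity>"
proof -
  define \<beta> where "\<beta> = (\<lambda>x. if x = a then enat (card P) else 0)"
  have \<beta>: "\<beta> \<in> cmsets A"
    using a by (auto simp: \<beta>_def cmsets_def zero_enat_def intro: countable_subset[of _ "{a}"])
  have "copies \<beta> = Pair a ` {..<card P}"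
    by (auto simp: \<beta>_def copies_def zero_enat_def split: if_splits)
  then have "finite (copies \<beta>)" "card (copies \<beta>) = card (copies (set_cmset P))"
    by (simp_all add: copies_set_cmset card_image inj_on_def)
  moreover have fin: "finite (copies (set_cmset P))"
    using P by (simp add: copies_set_cmset)
  ultimately obtain \<phi> where \<phi>: "bij_betw \<phi> (copies (set_cmset P)) (copies \<beta>)"
    by (metis finite_same_card_bij)
  have "matching_dist p (set_cmset P) \<beta> \<le> ennreal_rpow (match_cost p (set_cmset P) \<phi>) (1 / p)"
    unfolding matching_dist_def match_cost_def using \<phi> by (intro INF_lower) simp
  also have "\<dots> < \<infinity>"
    using match_cost_finite[OF fin, of p \<phi>] by (auto simp: ennreal_rpow_def)
  finally show ?thesis
    using rep_dist_le_matching_dist[OF cmsets_0 \<beta>, of p "set_cmset P" 0] by simp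
qed

text \<open>The cube of edge \<open>L\<close> consists of the diagrams with points at the positions \<open>K * L * (i + 1) + x i\<close>
  along the ray, for \<open>i < k\<close> and \<open>0 \<le> x i \<le> L\<close>. The factor \<open>K = 2 + 1 / c\<close> serves two purposes: with
  \<open>K \<ge> 2\<close>, positions with different indices differ by at least \<open>L\<close>, also between two diagrams; with
  \<open>c * K \<ge> 1\<close>, all points are at distance at least \<open>L\<close> from \<open>A\<close>. Since \<open>\<bar>x i - y i\<bar> \<le> L\<close>, the
  \<open>i\<close>-th point of one diagram has distance at least \<open>\<bar>x i - y i\<bar>\<close> from everything it can be
  matched with.\<close>

theorem infinite_dimensions_dgm_space:
  fixes X A :: "'a::metric_space set" and g :: "real \<Rightarrow> 'a"
  assumes p: "1 \<le> p" and A: "closed A" "A \<noteq> {}"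
    and ray: "\<And>s. 0 \<le> s \<Longrightarrow> g s \<in> X" "\<And>s t. 0 \<le> s \<Longrightarrow> 0 \<le> t \<Longrightarrow> dist (g s) (g t) = \<bar>s - t\<bar>"
    and diverges: "0 < c" "\<And>s a. 0 \<le> s \<Longrightarrow> a \<in> A \<Longrightarrow> c * s \<le> dist (g s) a"
  shows "Metric_space.hausdorff_dim (dgm_space p X A) (dgm_mdist p A) = \<infinity>"
    and "Metric_space.covering_dim (dgm_space p X A) (dgm_mdist p A) = \<infinity>"
    and "Metric_space.asymptotic_dim (dgm_space p X A) (dgm_mdist p A) = \<infinity>"
proof -
  interpret Metric_space "dgm_space p X A" "dgm_mdist p A"
    by (rule Metric_space_dgm_space[OF p A(1)])
  have "\<exists>e. cube_embedding k L e" if L: "0 < L" for k L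
  proof -
    define K where "K = 2 + 1 / c"
    have K: "2 \<le> K" "1 \<le> c * K"
      using diverges(1) by (simp_all add: K_def field_simps)
    define pos where "pos = (\<lambda>x i. K * L * (real i + 1) + x i)"
    define pt where "pt = (\<lambda>x i. g (pos x i))"
    define S where "S = (\<lambda>x. set_cmset (pt x ` {..<k}))"
    define e where "e = (\<lambda>x. dgm_rel X A `` {S x})"
    let ?Q = "{..<k} \<rightarrow> {0..L}"
    have pos_ge: "K * L \<le> pos x i" if "x \<in> ?Q" "i < k" for x i
      using that L K(1) by (auto simp: pos_def Pi_iff distrib_left)
    have pos0: "0 \<le> pos x i" if "x \<in> ?Q" "i < k" for x i
      using pos_ge[OF that] L K(1) by (meson mult_nonneg_nonneg order_trans less_imp_le zero_le_numeral)
    have pos_diff: "L \<le> \<bar>pos x i - pos y j\<bar>"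
      if "x \<in> ?Q" "y \<in> ?Q" "i < k" "j < k" "i \<noteq> j" for x y i j
    proof -
      have "2 * L * 1 \<le> K * L * \<bar>real i - real j\<bar>"
        using that(5) L K(1) by (intro mult_mono) auto
      also have "\<dots> = \<bar>K * L * (real i - real j)\<bar>"
        using L K(1) by (simp add: abs_mult)
      finally show ?thesis
        using that by (force simp: pos_def Pi_iff algebra_simps)
    qed
    have dist_pt: "dist (pt x i) (pt y j) = \<bar>pos x i - pos y j\<bar>"
      if "x \<in> ?Q" "y \<in> ?Q" "i < k" "j < k" for x y i j
      using that pos0 ray(2) by (simp add: pt_def)
    have dist_A: "L \<le> dist (pt x i) a" if "x \<in> ?Q" "i < k" "a \<in> A" for x i a
    proof -
      have "1 * L \<le> c * K * L"
        using K(2) L by (intro mult_right_mono) auto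
      also have "\<dots> \<le> c * pos x i"
        using pos_ge[OF that(1,2)] diverges(1) by simp
      also have "\<dots> \<le> dist (pt x i) a"
        using that pos0 diverges(2) by (simp add: pt_def)
      finally show ?thesis by simp
    qed
    have inj: "inj_on (pt x) {..<k}" if "x \<in> ?Q" for x
    proof (rule inj_onI, rule ccontr)
      fix i j assume "i \<in> {..<k}" "j \<in> {..<k}" "pt x i = pt x j" "i \<noteq> j"
      then show False
        using pos_diff[OF that that, of i j] dist_pt[OF that that, of i j] L by simp
    qed
    have SX: "S x \<in> cmsets X" if "x \<in> ?Q" for x
      unfolding S_def using pos0[OF that] ray(1) by (intro set_cmset_in_cmsets) (auto simp: pt_def)
    have S0: "rep_dist p A (S x) 0 < \<infinity>" for x
      using A(2) p rep_dist_set_cmset_0 unfolding S_def by blast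
    have dist_e: "dgm_mdist p A (e x) (e y) = enn2real (rep_dist p A (S x) (S y))"
      if "x \<in> ?Q" "y \<in> ?Q" for x y
      using SX that by (simp add: e_def dgm_mdist_def dgm_dist_class)
    have lower: "\<bar>x i - y i\<bar> \<le> dgm_mdist p A (e x) (e y)"
      if xy: "x \<in> ?Q" "y \<in> ?Q" and i: "i < k" for x y i
    proof -
      have "\<bar>x i - y i\<bar> \<le> dist (pt x i) z" if z: "z \<in> pt y ` {..<k} \<union> A" for z
      proof -
        have le: "\<bar>x i - y i\<bar> \<le> L"
          using xy i by (force simp: Pi_iff)
        consider j where "j < k" "z = pt y j" | "z \<in> A"
          using z by auto
        then show ?thesis
        proof cases
          case 1
          show ?thesis
          proof (cases "j = i")
            case True
            then show ?thesis
              using 1 dist_pt[OF xy i i] by (simp add: pos_def)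
          next
            case False
            then show ?thesis
              using 1 le dist_pt[OF xy i 1(1)] pos_diff[OF xy i 1(1)] by simp
          qed
        next
          case 2
          then show ?thesis
            using le dist_A[OF xy(1) i] by fastforce
        qed
      qed
      then have "ennreal \<bar>x i - y i\<bar> \<le> rep_dist p A (S x) (S y)"
        unfolding S_def using i p by (intro rep_dist_set_cmset_ge[of p "pt x i"]) auto
      then have "enn2real (ennreal \<bar>x i - y i\<bar>) \<le> enn2real (rep_dist p A (S x) (S y))"
        using rep_dist_finite[OF p S0 S0] by (intro enn2real_mono) auto
      then show ?thesis
        using dist_e[OF xy] by simp
    qed
    have upper: "dgm_mdist p A (e x) (e y) \<le> real k * \<delta>"
      if xy: "x \<in> ?Q" "y \<in> ?Q" and \<delta>: "\<And>i. i < k \<Longrightarrow> \<bar>x i - y i\<bar> \<le> \<delta>" for x y \<delta>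
    proof -
      \<comment> \<open>for \<open>k = 0\<close> the bound \<open>\<delta>\<close> may be negative\<close>
      have close: "dist (pt x i) (pt y i) \<le> max 0 \<delta>" if "i \<in> {..<k}" for i
        using \<delta>[of i] dist_pt[OF xy, of i i] that by (simp add: pos_def)
      have "rep_dist p A (S x) (S y) \<le> matching_dist p (S x) (S y)"
        using rep_dist_le_matching_dist[OF cmsets_0 cmsets_0] by fastforce
      also have "\<dots> \<le> ennreal (real (card {..<k}) * max 0 \<delta>)"
        unfolding S_def by (intro matching_dist_set_cmset_le p inj xy close) auto
      finally have "enn2real (rep_dist p A (S x) (S y)) \<le> real k * max 0 \<delta>"
        by (intro enn2real_leI) auto
      moreover have "real k * max 0 \<delta> = real k * \<delta>"
        using \<delta>[of 0] by (cases "k = 0") (auto simp: max_def)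
      ultimately show ?thesis
        using dist_e[OF xy] by simp
    qed
    have "e x \<in> dgm_space p X A" if "x \<in> ?Q" for x
      unfolding e_def using SX[OF that] S0 by (rule dgm_space_classI)
    then have "cube_embedding k L e"
      unfolding cube_embedding_def using lower upper by blast
    then show ?thesis
      by blast
  qed
  note infinite = infinite_dimensions_if_cubes[OF this]
  show "hausdorff_dim = \<infinity>" "covering_dim = \<infinity>" "asymptotic_dim = \<infinity>"
    using infinite by blast+
qed

section \<open>The Euclidean pairs\<close>

lemma closed_diag: "closed (diag :: ((real ^ 'n) \<times> (real ^ 'n)) set)"
proof -
  have "diag = {z :: (real ^ 'n) \<times> (real ^ 'n). fst z = snd z}"
    by (auto simp: diag_def)
  also have "closed \<dots>"
    by (intro closed_Collect_eq continuous_intros)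
  finally show ?thesis .
qed

lemma closed_euclid:
  "closed (euclid_plus :: ((real ^ 'n) \<times> (real ^ 'n)) set)"
  "closed (euclid_nonneg :: ((real ^ 'n) \<times> (real ^ 'n)) set)"
proof -
  have "euclid_plus = (\<Inter>i. {z :: (real ^ 'n) \<times> (real ^ 'n). fst z $ i \<le> snd z $ i})"
    by (auto simp: euclid_plus_def)
  also have "closed \<dots>"
    by (intro closed_INT ballI closed_Collect_le continuous_intros)
  finally show "closed (euclid_plus :: ((real ^ 'n) \<times> (real ^ 'n)) set)" .
  have "euclid_nonneg = (\<Inter>i. {z :: (real ^ 'n) \<times> (real ^ 'n). 0 \<le> fst z $ i}) \<inter>
      (\<Inter>i. {z. fst z $ i \<le> snd z $ i})"
    by (auto simp: euclid_nonneg_def)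
  also have "closed \<dots>"
    by (intro closed_Int closed_INT ballI closed_Collect_le continuous_intros)
  finally show "closed (euclid_nonneg :: ((real ^ 'n) \<times> (real ^ 'n)) set)" .
qed

lemma dist_diag_ge:
  fixes y :: "real ^ 'n"
  assumes "a \<in> diag"
  shows "norm y / 2 \<le> dist (0, y) a"
proof -
  obtain v where a: "a = (v, v)"
    using assms by (auto simp: diag_def)
  have "norm y \<le> norm v + norm (y - v)"
    by (metis add.commute diff_add_cancel norm_triangle_ineq)
  also have "norm v \<le> dist (0, y) a"
    using dist_fst_le[of "(0, y)" a] by (simp add: a)
  also have "norm (y - v) \<le> dist (0, y) a"
    using dist_snd_le[of "(0, y)" a] by (simp add: a dist_norm)
  finally show ?thesis by simp
qed

text \<open>The ray runs from the origin along one of the second coordinates. It lies in all three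
  spaces, and its distance from the diagonal grows at least at rate \<open>1 / 2\<close>.\<close>

theorem corollary7p5:
  fixes X A :: "((real ^ 'n) \<times> (real ^ 'n)) set" and p :: real
  assumes "1 \<le> p"
    and "X \<in> {UNIV, euclid_plus, euclid_nonneg}"
    and "A = diag \<inter> X"
  shows "Metric_space.hausdorff_dim (dgm_space p X A) (dgm_mdist p A) = \<infinity> \<and>
         Metric_space.covering_dim (dgm_space p X A) (dgm_mdist p A) = \<infinity> \<and>
         Metric_space.asymptotic_dim (dgm_space p X A) (dgm_mdist p A) = \<infinity>"
proof -
  fix i0 :: 'n
  define g :: "real \<Rightarrow> (real ^ 'n) \<times> (real ^ 'n)" where "g = (\<lambda>s. (0, s *\<^sub>R axis i0 1))"
  have gX: "g s \<in> X" if "0 \<le> s" for s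
    using assms(2) that by (auto simp: g_def euclid_plus_def euclid_nonneg_def axis_def)
  have "closed X"
    using assms(2) closed_euclid by auto
  then have "closed A"
    unfolding assms(3) by (intro closed_Int closed_diag)
  moreover have "g 0 \<in> A"
    using gX[of 0] by (auto simp: assms(3) g_def diag_def)
  then have "A \<noteq> {}"
    by blast
  moreover have "dist (g s) (g t) = \<bar>s - t\<bar>" for s t
    by (simp add: g_def dist_Pair_Pair dist_norm norm_axis_1 flip: scaleR_diff_left)
  moreover have "1 / 2 * s \<le> dist (g s) a" if "0 \<le> s" "a \<in> A" for s a
    using dist_diag_ge[of a "s *\<^sub>R axis i0 1"] that by (simp add: g_def assms(3) norm_axis_1)
  ultimately show ?thesis
    using infinite_dimensions_dgm_space[OF assms(1), of A g X "1 / 2"] gX by auto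
qed

end
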